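(* Let $n,k,p,r$ be nonnegative integers with $n+p\geq 1$. There is a bijection between (i) the set of involutive Baxter permutations (of size $2n+p$) with $2n$ non-fixed points, $p$ fixed points, $2k$ descents not crossing the diagonal, and $r$ descents crossing the diagonal; and (ii) the set of $4$-tuples $(W_1,W_2,W_3,S)$ where $(W_1,W_2,W_3)$ is a non-intersecting triple of binary walks such that $W_1$ goes from $(-1,1)$ to $(k-1,n+p-k)$, $W_2$ goes from $(0,0)$ to $(k,n+p-k-1)$, $W_3$ goes from $(0,-1)$ to $(k+r,n-k-r-1)$, and where $S$ is a sequence of $r+1$ nonnegative integers adding up to $p$.
   Context: A permutation $\pi\in\mathfrak{S}_N$ is a Baxter permutation if it avoids the patterns $2\text{-}41\text{-}3$ and $3\text{-}14\text{-}2$, i.e. there are no indices $i<j<j+1<l$ with $\pi(j+1)<\pi(i)<\pi(l)<\pi(j)$, and no indices $i<j<j+1<l$ with $\pi(j)<\pi(l)<\pi(i)<\pi(j+1)$. It is involutive if $\pi^{-1}=\pi$. A descent of $\pi\in\mathfrak{S}_N$ is an integer $i\in\{1,\dots,N-1\}$ such that $\pi(i)>\pi(i+1)$. A descent $i$ crosses the diagonal if $\pi(i)>i$ and $\pi(i+1)<i+1$. A binary walk is a finite (possibly empty) oriented walk in $\mathbb{Z}^2$ with steps East $(+1,0)$ and North $(0,+1)$. A triple of walks is non-intersecting if no two of the walks share a lattice point (end-points included). *)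

theory Defs
  imports Main "HOL-Combinatorics.Permutations"
begin

text \<open>
  A permutation of size N is a function f :: nat \<Rightarrow> nat with f permutes {1..N}; it is the
  identity outside {1..N}, so distinct permutations are distinct functions.
\<close>

definition baxter :: "nat \<Rightarrow> (nat \<Rightarrow> nat) \<Rightarrow> bool" where
  "baxter N f \<longleftrightarrow> f permutes {1..N} \<and>
     \<not> (\<exists>i\<in>{1..N}. \<exists>j\<in>{1..N}. \<exists>l\<in>{1..N}. i < j \<and> j + 1 < l \<and>
          f (j + 1) < f i \<and> f i < f l \<and> f l < f j) \<and>
     \<not> (\<exists>i\<in>{1..N}. \<exists>j\<in>{1..N}. \<exists>l\<in>{1..N}. i < j \<and> j + 1 < l \<and>
          f j < f l \<and> f l < f i \<and> f i < f (j + 1))"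

definition involutive :: "(nat \<Rightarrow> nat) \<Rightarrow> bool" where
  "involutive f \<longleftrightarrow> inv f = f"

definition fixed_points :: "nat \<Rightarrow> (nat \<Rightarrow> nat) \<Rightarrow> nat set" where
  "fixed_points N f = {i \<in> {1..N}. f i = i}"

definition non_fixed_points :: "nat \<Rightarrow> (nat \<Rightarrow> nat) \<Rightarrow> nat set" where
  "non_fixed_points N f = {i \<in> {1..N}. f i \<noteq> i}"

definition descents :: "nat \<Rightarrow> (nat \<Rightarrow> nat) \<Rightarrow> nat set" where
  "descents N f = {i. 1 \<le> i \<and> i < N \<and> f i > f (i + 1)}"

definition crosses_diagonal :: "(nat \<Rightarrow> nat) \<Rightarrow> nat \<Rightarrow> bool" where
  "crosses_diagonal f i \<longleftrightarrow> f i > i \<and> f (i + 1) < i + 1"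

definition involutive_baxter_permutations :: "nat \<Rightarrow> nat \<Rightarrow> nat \<Rightarrow> nat \<Rightarrow> (nat \<Rightarrow> nat) set" where
  "involutive_baxter_permutations n k p r =
     {f. baxter (2 * n + p) f \<and> involutive f \<and>
         card (non_fixed_points (2 * n + p) f) = 2 * n \<and>
         card (fixed_points (2 * n + p) f) = p \<and>
         card {i \<in> descents (2 * n + p) f. \<not> crosses_diagonal f i} = 2 * k \<and>
         card {i \<in> descents (2 * n + p) f. crosses_diagonal f i} = r}"

type_synonym point = "int \<times> int"

definition binary_step :: "point \<Rightarrow> point \<Rightarrow> bool" where
  "binary_step a b \<longleftrightarrow> b = (fst a + 1, snd a) \<or> b = (fst a, snd a + 1)"

text \<open>
  A walk is the nonempty list of the lattice points it visits; the walk without steps from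
  a to a is [a].
\<close>

definition binary_walk :: "point \<Rightarrow> point \<Rightarrow> point list \<Rightarrow> bool" where
  "binary_walk a b w \<longleftrightarrow> w \<noteq> [] \<and> hd w = a \<and> last w = b \<and> successively binary_step w"

definition non_intersecting :: "point list \<Rightarrow> point list \<Rightarrow> point list \<Rightarrow> bool" where
  "non_intersecting w1 w2 w3 \<longleftrightarrow>
     set w1 \<inter> set w2 = {} \<and> set w1 \<inter> set w3 = {} \<and> set w2 \<inter> set w3 = {}"

definition walk_tuples ::
    "nat \<Rightarrow> nat \<Rightarrow> nat \<Rightarrow> nat \<Rightarrow> (point list \<times> point list \<times> point list \<times> nat list) set" where
  "walk_tuples n k p r =
     {(w1, w2, w3, s).
        binary_walk (-1, 1) (int k - 1, int n + int p - int k) w1 \<and>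
        binary_walk (0, 0) (int k, int n + int p - int k - 1) w2 \<and>
        binary_walk (0, -1) (int k + int r, int n - int k - int r - 1) w3 \<and>
        non_intersecting w1 w2 w3 \<and>
        length s = r + 1 \<and> sum_list s = p}"

end

(*
  Deleting the last point of an involutive Baxter permutation together with its mirror image
  leaves an involutive Baxter permutation.  Let a be the number of left-to-right maxima and b the
  number of right-to-left maxima strictly above the diagonal.  In the resulting generating tree a
  node (a, b) has the children (a + 1, 0) (append a fixed point), (a + 1, 1) (append an adjacent
  transposition, the only move that creates a descent crossing the diagonal), (s, b + 1) for
  1 <= s <= a (two new descents, none crossing) and (a + 1, t) for 1 <= t <= b (no new descent).

  Along a branch, record True for a move of the third kind and False for the others.  Given this
  word, the histories of a and those of b are independent.  Read backwards from its end point, the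
  word is the walk W2; the histories of a correspond to the walks W1 above it.  Among the histories
  of b with p resets to 0 and r resets to 1, the order of the resets is immaterial: it contributes
  the factor (p + r choose r), which counts the sequences S, and what remains are the walks W3
  below W2.
*)

theory Submission
  imports Defs
begin

section \<open>Histories of the labels along a word of moves\<close>

text \<open>No bijection is written down: both sets are finite, and each has as many elements as a
  sum over words of \<open>drops\<close>, a binomial coefficient and \<open>gaps\<close> multiplied
  together. The obstacle on the permutation side is that the forbidden patterns ask for adjacent
  positions, so their symmetry under inversion is hidden, while a mirrored pair adds both a new
  largest value and a new last value. Once avoidance is known to be invariant under inversion, a new
  last value is the inverse of a new maximum, and only the insertion of a maximum has to be
  analysed. The condition "above the diagonal" comes from the new last value, which hides every
  right-to-left maximum smaller than it. On the side of the walks, \<open>W1\<close> and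
  \<open>W3\<close> only have to be kept off \<open>W2\<close>: it separates them, so they cannot
  meet each other, and for a fixed \<open>W2\<close> the count is a product.\<close>

lemma finite_words: "finite {w :: bool list. length w = m}"
  using finite_lists_length_eq[of "UNIV :: bool set" m] by simp

text \<open>
  Histories of the label \<open>a\<close>; also the walks \<open>W1\<close> above a walk \<open>W2\<close> given by the word, where \<open>W1\<close>
  ends one column to the left of the end of \<open>W2\<close> and \<open>a\<close> rows above it.
\<close>

fun drops :: "bool list \<Rightarrow> nat \<Rightarrow> nat" where
  "drops [] a = 1"
| "drops (True # w) a = (\<Sum>s=1..a. drops w s)"
| "drops (False # w) a = drops w (Suc a)"

text \<open>
  Walks \<open>W3\<close> below a walk \<open>W2\<close> given by the word, where \<open>W3\<close> ends \<open>g\<close> columns to the right of the end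
  of \<open>W2\<close> and \<open>q + 1\<close> rows below it: read backwards, \<open>W2\<close> descends \<open>q\<close> rows before \<open>W3\<close> matters.
\<close>

fun gaps :: "bool list \<Rightarrow> nat \<Rightarrow> nat \<Rightarrow> nat" where
  "gaps [] g q = (if q = 0 then 1 else 0)"
| "gaps (True # w) g q = gaps w (Suc g) q"
| "gaps (False # w) g 0 = (\<Sum>t=1..g. gaps w t 0)"
| "gaps (False # w) g (Suc q) = gaps w g q"

text \<open>Histories of the label \<open>b\<close> with \<open>p\<close> resets to 0 and \<open>r\<close> resets to 1.\<close>

fun fills :: "bool list \<Rightarrow> nat \<Rightarrow> nat \<Rightarrow> nat \<Rightarrow> nat" where
  "fills [] b p r = (if p = 0 \<and> r = 0 then 1 else 0)"
| "fills (True # w) b p r = fills w (Suc b) p r"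
| "fills (False # w) b p r = (\<Sum>t=1..b. fills w t p r)
     + (if p = 0 then 0 else fills w 0 (p - 1) r) + (if r = 0 then 0 else fills w 1 p (r - 1))"

text \<open>Geometrically: the last step of \<open>W3\<close> is East or North.\<close>

lemma gaps_step: "gaps w (Suc g) q = gaps w g q + gaps w (Suc g) (Suc q)"
  by (induction w g q rule: gaps.induct) (auto simp: gr0_conv_Suc)

lemma gaps_sum: "gaps w (b + g) q = gaps w g q + (\<Sum>t=1..b. gaps w (t + g) (Suc q))"
  by (induction b) (simp_all add: gaps_step[of w _ q])

text \<open>The offset \<open>b + r\<close> makes both resets lead to the same number
  \<open>gaps w r (p + r - 1)\<close>: a reset to 0 leaves \<open>b = 0\<close> with
  \<open>r\<close> resets to 1 to come, a reset to 1 leaves \<open>b = 1\<close> with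
  \<open>r - 1\<close> to come. Their coefficients add up by Pascal's rule, and
  \<open>gaps_sum\<close> joins the result to the sum over \<open>t\<close>.\<close>

lemma fills_eq: "fills w b p r = ((p + r) choose r) * gaps w (b + r) (p + r)"
proof (induction w b p r rule: fills.induct)
  case (1 b p r)
  then show ?case by auto
next
  case (2 w b p r)
  then show ?case by simp
next
  case (3 w b p r)
  have S: "(\<Sum>t=1..b. fills w t p r) = ((p + r) choose r) * (\<Sum>t=1..b. gaps w (t + r) (p + r))"
    using 3(1) by (simp add: sum_distrib_left)
  show ?case
  proof (cases "p + r")
    case 0
    with S show ?thesis by simp
  next
    case (Suc q)
    have F: "(if p = 0 then 0 else fills w 0 (p - 1) r) =
        (if p = 0 then 0 else (q choose r)) * gaps w r q"
      using 3(2) Suc by (cases p) auto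
    have T: "(if r = 0 then 0 else fills w 1 p (r - 1)) =
        (if r = 0 then 0 else (q choose (r - 1))) * gaps w r q"
      using 3(3) Suc by (cases r) auto
    have C: "(if p = 0 then 0 else (q choose r)) + (if r = 0 then 0 else (q choose (r - 1)))
        = (Suc q choose r)"
      using Suc by (cases r) (auto simp: binomial_eq_0)
    have "fills (False # w) b p r = (Suc q choose r) * (\<Sum>t=1..b. gaps w (t + r) (Suc q))
        + (Suc q choose r) * gaps w r q"
      unfolding fills.simps S F T C[symmetric] Suc by (simp add: algebra_simps)
    also have "\<dots> = (Suc q choose r) * gaps w (b + r) q"
      unfolding gaps_sum[of w b r q] by (simp add: algebra_simps)
    finally show ?thesis using Suc by simp
  qed
qed

text \<open>
  The same histories with accumulating statistics: \<open>d\<close> non-crossing descents, \<open>q\<close> fixed points and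
  \<open>c\<close> crossing descents so far.
\<close>

fun runs :: "nat \<Rightarrow> nat \<Rightarrow> nat \<Rightarrow> bool list \<Rightarrow> nat \<Rightarrow> nat \<Rightarrow> nat \<Rightarrow> nat \<Rightarrow> nat" where
  "runs k p r [] b d q c = (if d = 2 * k \<and> q = p \<and> c = r then 1 else 0)"
| "runs k p r (True # w) b d q c = runs k p r w (Suc b) (d + 2) q c"
| "runs k p r (False # w) b d q c = (\<Sum>t=1..b. runs k p r w t d q c)
     + runs k p r w 0 d (Suc q) c + runs k p r w 1 d q (Suc c)"

text \<open>Each letter \<open>True\<close> adds 2 to \<open>d\<close> and nothing else changes it,
  so its final value depends on the word alone. While \<open>runs\<close> counts the resets made so
  far, \<open>fills\<close> counts down those still due; the guards keep the subtractions
  exact.\<close>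

lemma runs_eq_fills: "runs k p r w b d q c =
  (if d + 2 * count_list w True = 2 * k \<and> q \<le> p \<and> c \<le> r then fills w b (p - q) (r - c) else 0)"
proof (induction w arbitrary: b d q c)
  case Nil
  then show ?case by auto
next
  case (Cons x w)
  then show ?case by (cases x) auto
qed

lemma sum_words_Suc:
  fixes f :: "bool list \<Rightarrow> nat"
  shows "(\<Sum>w | length w = Suc m. f w) =
    (\<Sum>w | length w = m. f (True # w)) + (\<Sum>w | length w = m. f (False # w))"
proof -
  have "{w. length w = Suc m} = (#) True ` {w. length w = m} \<union> (#) False ` {w. length w = m}"
    by (auto simp: length_Suc_conv)
  moreover have "(#) True ` {w. length w = m} \<inter> (#) False ` {w. length w = m} = {}"
    by auto
  ultimately show ?thesis
    by (simp add: sum.union_disjoint sum.reindex finite_words)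
qed

section \<open>Inserting a maximum into a Baxter permutation\<close>

definition lr_maxima :: "nat \<Rightarrow> (nat \<Rightarrow> nat) \<Rightarrow> nat set" where
  "lr_maxima N f = {i \<in> {1..N}. \<forall>j\<in>{1..<i}. f j < f i}"

definition rl_maxima :: "nat \<Rightarrow> (nat \<Rightarrow> nat) \<Rightarrow> nat set" where
  "rl_maxima N f = {i \<in> {1..N}. \<forall>j\<in>{i<..N}. f j < f i}"

text \<open>These are the places for a new maximum in the generating tree of all Baxter
  permutations: just before a left-to-right maximum or just after a right-to-left maximum. The case
  \<open>m = Suc N\<close> also covers the empty permutation.\<close>

definition active :: "nat \<Rightarrow> (nat \<Rightarrow> nat) \<Rightarrow> nat \<Rightarrow> bool" where
  "active N f m \<longleftrightarrow> m = Suc N \<or> m \<in> lr_maxima N f \<or> m - 1 \<in> rl_maxima N f"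

text \<open>Renumbering that leaves \<open>m\<close> free; it acts on positions when a maximum is
  inserted and on values when a last value is appended.\<close>

definition shift :: "nat \<Rightarrow> nat \<Rightarrow> nat" where
  "shift m x = (if x < m then x else Suc x)"

definition ins_max :: "nat \<Rightarrow> nat \<Rightarrow> (nat \<Rightarrow> nat) \<Rightarrow> nat \<Rightarrow> nat" where
  "ins_max N m f x =
    (if x < m then f x else if x = m then Suc N else if x \<le> Suc N then f (x - 1) else x)"

definition ins_last :: "nat \<Rightarrow> nat \<Rightarrow> (nat \<Rightarrow> nat) \<Rightarrow> nat \<Rightarrow> nat" where
  "ins_last N m f x = (if x \<le> N then shift m (f x) else if x = Suc N then m else x)"

definition avoids :: "nat \<Rightarrow> (nat \<Rightarrow> nat) \<Rightarrow> bool" where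
  "avoids N f \<longleftrightarrow> (\<forall>i j l. 1 \<le> i \<and> i < j \<and> Suc j < l \<and> l \<le> N \<longrightarrow>
     \<not> (f (Suc j) < f i \<and> f i < f l \<and> f l < f j) \<and>
     \<not> (f j < f l \<and> f l < f i \<and> f i < f (Suc j)))"

lemma avoidsD:
  assumes "avoids N f" "1 \<le> i" "i < j" "Suc j < l" "l \<le> N"
  shows "\<not> (f (Suc j) < f i \<and> f i < f l \<and> f l < f j)"
    "\<not> (f j < f l \<and> f l < f i \<and> f i < f (Suc j))"
  using assms unfolding avoids_def by blast+

lemma baxter_avoids: "baxter N f \<longleftrightarrow> f permutes {1..N} \<and> avoids N f"
proof -
  have "avoids N f \<longleftrightarrow>
     \<not> (\<exists>i\<in>{1..N}. \<exists>j\<in>{1..N}. \<exists>l\<in>{1..N}. i < j \<and> j + 1 < l \<and>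
          f (j + 1) < f i \<and> f i < f l \<and> f l < f j) \<and>
     \<not> (\<exists>i\<in>{1..N}. \<exists>j\<in>{1..N}. \<exists>l\<in>{1..N}. i < j \<and> j + 1 < l \<and>
          f j < f l \<and> f l < f i \<and> f i < f (j + 1))" (is "_ \<longleftrightarrow> ?R")
  proof
    assume "avoids N f"
    then show ?R unfolding avoids_def Bex_def atLeastAtMost_iff Suc_eq_plus1 by blast
  next
    assume R: ?R
    show "avoids N f"
      unfolding avoids_def
    proof (intro allI impI)
      fix i j l assume "1 \<le> i \<and> i < j \<and> Suc j < l \<and> l \<le> N"
      then have "i \<in> {1..N}" "j \<in> {1..N}" "l \<in> {1..N}" "i < j" "j + 1 < l" by auto
      with R show "\<not> (f (Suc j) < f i \<and> f i < f l \<and> f l < f j) \<and>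
          \<not> (f j < f l \<and> f l < f i \<and> f i < f (Suc j))"
        by (metis Suc_eq_plus1)
    qed
  qed
  then show ?thesis unfolding baxter_def by blast
qed

lemma permutes_range: "f permutes {1..N} \<Longrightarrow> 1 \<le> x \<Longrightarrow> x \<le> N \<Longrightarrow> 1 \<le> f x \<and> f x \<le> N"
  using permutes_in_image[of f "{1..N}" x] by auto

lemma ins_max_shift: "x \<le> N \<Longrightarrow> ins_max N m f (shift m x) = f x"
  by (auto simp: ins_max_def shift_def)

lemma ins_max_at: "ins_max N m f m = Suc N"
  by (simp add: ins_max_def)

lemma shift_less_iff [simp]: "shift m x < shift m y \<longleftrightarrow> x < y"
  by (auto simp: shift_def)

lemma shift_eq_iff [simp]: "shift m x = shift m y \<longleftrightarrow> x = y"
  by (auto simp: shift_def)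

lemma shift_neq [simp]: "shift m x \<noteq> m" "m \<noteq> shift m x"
  by (auto simp: shift_def)

lemma shift_Suc: "Suc j \<noteq> m \<Longrightarrow> shift m (Suc j) = Suc (shift m j)"
  by (auto simp: shift_def)

lemma shift_less_same [simp]: "shift m x < m \<longleftrightarrow> x < m" "m < shift m x \<longleftrightarrow> m \<le> x"
  by (auto simp: shift_def)

lemma ex_shift:
  assumes "1 \<le> y" "y \<le> Suc N" "y \<noteq> m" "1 \<le> m" "m \<le> Suc N"
  obtains x where "1 \<le> x" "x \<le> N" "y = shift m x"
proof (cases "y < m")
  case True
  with assms that[of y] show ?thesis by (auto simp: shift_def)
next
  case False
  with assms that[of "y - 1"] show ?thesis by (auto simp: shift_def)
qed

lemma ins_max_permutes:
  assumes f: "f permutes {1..N}" and m: "1 \<le> m" "m \<le> Suc N"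
  shows "ins_max N m f permutes {1..Suc N}"
proof (rule bij_imp_permutes)
  let ?g = "ins_max N m f"
  have sub: "?g ` {1..Suc N} \<subseteq> {1..Suc N}"
  proof
    fix z assume "z \<in> ?g ` {1..Suc N}"
    then obtain y where y: "1 \<le> y" "y \<le> Suc N" "z = ?g y" by auto
    show "z \<in> {1..Suc N}"
    proof (cases "y = m")
      case True then show ?thesis using y ins_max_at by auto
    next
      case False
      obtain x where "1 \<le> x" "x \<le> N" "y = shift m x" using ex_shift[OF y(1,2) False m] .
      then show ?thesis using y(3) permutes_range[OF f, of x] by (auto simp: ins_max_shift)
    qed
  qed
  have "inj_on ?g {1..Suc N}"
  proof (rule inj_onI)
    fix y z assume "y \<in> {1..Suc N}" "z \<in> {1..Suc N}" and e: "?g y = ?g z"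
    then have yz: "1 \<le> y" "y \<le> Suc N" "1 \<le> z" "z \<le> Suc N" by auto
    have neq: "?g x \<noteq> Suc N" if x: "1 \<le> x" "x \<le> Suc N" "x \<noteq> m" for x
    proof -
      obtain x' where "1 \<le> x'" "x' \<le> N" "x = shift m x'" using ex_shift[OF x m] .
      then show ?thesis using permutes_range[OF f, of x'] by (auto simp: ins_max_shift)
    qed
    show "y = z"
    proof (cases "y = m \<or> z = m")
      case True
      then show ?thesis using neq[of y] neq[of z] e yz ins_max_at[of N m f] by metis
    next
      case False
      then have "y \<noteq> m" "z \<noteq> m" by auto
      obtain y' where y': "1 \<le> y'" "y' \<le> N" "y = shift m y'"
        using ex_shift[OF yz(1,2) \<open>y \<noteq> m\<close> m] .
      obtain z' where z': "1 \<le> z'" "z' \<le> N" "z = shift m z'"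
        using ex_shift[OF yz(3,4) \<open>z \<noteq> m\<close> m] .
      have "f y' = f z'" using e y' z' by (simp add: ins_max_shift)
      then show ?thesis using injD[OF permutes_inj[OF f]] y' z' by simp
    qed
  qed
  then show "bij_betw ?g {1..Suc N} {1..Suc N}"
    using sub by (simp add: bij_betw_def endo_inj_surj)
  fix x assume "x \<notin> {1..Suc N}"
  then show "?g x = x" using m permutes_not_in[OF f, of x] by (auto simp: ins_max_def)
qed

text \<open>A new maximum can only play the 4 of a pattern, and then one of its neighbours plays the
  1; \<open>active\<close> excludes exactly this. All other patterns are inherited from
  \<open>f\<close>, or come from an adjacent pair of \<open>f\<close> that the maximum
  splits.\<close>

lemma ins_max_baxter_iff:
  assumes f: "f permutes {1..N}" and m: "1 \<le> m" "m \<le> Suc N"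
  shows "baxter (Suc N) (ins_max N m f) \<longleftrightarrow> baxter N f \<and> active N f m"
proof -
  let ?g = "ins_max N m f"
  note sh = ins_max_shift[of _ N m f]
  have at: "?g m = Suc N" by (rule ins_max_at)
  have rng: "f x < Suc N" if "1 \<le> x" "x \<le> N" for x
    using permutes_range[OF f that] by simp
  have "avoids (Suc N) ?g \<longleftrightarrow> avoids N f \<and> active N f m"
  proof
    assume A: "avoids (Suc N) ?g"
    have "avoids N f"
      unfolding avoids_def
    proof (intro allI impI)
      fix i j l assume ijl: "1 \<le> i \<and> i < j \<and> Suc j < l \<and> l \<le> N"
      have s: "1 \<le> shift m i" "shift m l \<le> Suc N"
        using ijl by (auto simp: shift_def)
      have v: "?g (shift m i) = f i" "?g (shift m j) = f j" "?g (shift m (Suc j)) = f (Suc j)"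
        "?g (shift m l) = f l"
        using ijl by (auto intro!: sh)
      show "\<not> (f (Suc j) < f i \<and> f i < f l \<and> f l < f j) \<and>
          \<not> (f j < f l \<and> f l < f i \<and> f i < f (Suc j))"
      proof (cases "Suc j = m")
        case False
        then show ?thesis
          using avoidsD[OF A, of "shift m i" "shift m j" "shift m l"] ijl s v
          by (simp add: shift_Suc[symmetric])
      next
        case True
        \<comment> \<open>The maximum splits the adjacent pair of the pattern. It takes over the
          role of the 4, and the entry playing the 1 is next to it, so a pattern survives.\<close>
        then have e: "shift m i = i" "shift m j = j" "shift m (Suc j) = Suc m" "shift m l = Suc l"
          using ijl by (auto simp: shift_def)
        show ?thesis
          using avoidsD(1)[OF A, of i m "Suc l"] avoidsD(2)[OF A, of i j "Suc l"]
            ijl v True at rng[of i] rng[of l] unfolding e by auto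
      qed
    qed
    moreover have "active N f m"
    proof (rule ccontr)
      assume na: "\<not> active N f m"
      then have mN: "m \<le> N" using m by (auto simp: active_def)
      have m1: "m \<noteq> 1" using na mN by (auto simp: active_def lr_maxima_def)
      have ne: "f (m - 1) \<noteq> f m" using injD[OF permutes_inj[OF f], of "m - 1" m] m m1 by auto
      obtain i where i: "1 \<le> i" "i < m" "f m \<le> f i"
        using na m mN by (auto simp: active_def lr_maxima_def not_less)
      obtain l where l: "m - 1 < l" "l \<le> N" "f (m - 1) \<le> f l"
        using na m mN m1 by (auto simp: active_def rl_maxima_def not_less)
      have vm: "?g (Suc m) = f m" "?g (m - 1) = f (m - 1)" "Suc (m - 1) = m" "?g i = f i"
        "?g (Suc l) = f l"
        using sh[of m] sh[of "m - 1"] sh[of i] sh[of l] mN m m1 i l by (auto simp: shift_def split: if_splits)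
      have ni: "f i \<noteq> f m" "f l \<noteq> f (m - 1)"
        using injD[OF permutes_inj[OF f], of i m] injD[OF permutes_inj[OF f], of l "m - 1"] i l
        by auto
      \<comment> \<open>The smaller neighbour of the new maximum plays the 1 and the larger one the
        2; the 3 is played by \<open>i\<close> if \<open>f (m - 1) < f m\<close>, and by
        \<open>l\<close> otherwise.\<close>
      show False
      proof (cases "f (m - 1) < f m")
        case True
        then have "i < m - 1" using i by (cases "i = m - 1") auto
        then show False
          using avoidsD(2)[OF A i(1), of "m - 1" "Suc m"] i True ni mN rng[of i]
          unfolding vm at by auto
      next
        case False
        then have lm: "f m < f (m - 1)" using ne by simp
        then have "m < l" using l by (cases "l = m") auto
        then have h: "1 \<le> m - 1" "m - 1 < m" "Suc m < Suc l" "Suc l \<le> Suc N"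
          using m m1 l by auto
        show False
          using avoidsD(1)[OF A h] l lm ni rng[of l] h unfolding vm at by auto
      qed
    qed
    ultimately show "avoids N f \<and> active N f m" ..
  next
    assume B: "avoids N f \<and> active N f m"
    then have A: "avoids N f" ..
    show "avoids (Suc N) ?g"
      unfolding avoids_def
    proof (intro allI impI)
      fix i j l assume ijl: "1 \<le> i \<and> i < j \<and> Suc j < l \<and> l \<le> Suc N"
      have le: "?g x \<le> Suc N" if "1 \<le> x" "x \<le> Suc N" for x
        using permutes_range[OF ins_max_permutes[OF f m], of x] that by simp
      show "\<not> (?g (Suc j) < ?g i \<and> ?g i < ?g l \<and> ?g l < ?g j) \<and>
          \<not> (?g j < ?g l \<and> ?g l < ?g i \<and> ?g i < ?g (Suc j))"
      proof (cases "i = m \<or> l = m")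
        case True
        then show ?thesis using at le[of i] le[of l] le[of j] le[of "Suc j"] ijl by auto
      next
        case il: False
        have b: "1 \<le> i" "i \<le> Suc N" "i \<noteq> m" "1 \<le> l" "l \<le> Suc N" "l \<noteq> m"
          "1 \<le> j" "j \<le> Suc N"
          using ijl il by auto
        obtain i' where i': "1 \<le> i'" "i' \<le> N" "i = shift m i'"
          using ex_shift[OF b(1-3) m] .
        obtain l' where l': "1 \<le> l'" "l' \<le> N" "l = shift m l'"
          using ex_shift[OF b(4-6) m] .
        have v: "?g i = f i'" "?g l = f l'" using sh i' l' by auto
        show ?thesis
        proof (cases "j = m")
          case True
          have mN: "m \<le> N" using ijl True by auto
          have e: "i = i'" "l = Suc l'" "?g (Suc j) = f m"
            using ijl True i' l' sh[of m] mN by (auto simp: shift_def split: if_splits)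
          \<comment> \<open>Here the maximum would be the 4 and \<open>f m\<close> the 1 of 2-41-3.
            A left-to-right maximum at \<open>m\<close> is not below \<open>f i'\<close>; a
            right-to-left maximum at \<open>m - 1\<close> could replace the new maximum as the 4,
            giving a pattern of \<open>f\<close>. The case \<open>Suc j = m\<close> below is the
            mirror image.\<close>
          have "\<not> (?g (Suc j) < ?g i \<and> ?g i < ?g l)"
            unfolding v e(3)
          proof
            assume c: "f m < f i' \<and> f i' < f l'"
            from B mN consider "m \<in> lr_maxima N f" | "m - 1 \<in> rl_maxima N f"
              by (auto simp: active_def)
            then show False
            proof cases
              case 1
              then have "\<forall>j\<in>{1..<m}. f j < f m" by (simp add: lr_maxima_def)
              moreover have "i' \<in> {1..<m}" using i'(1) e(1) True ijl by auto
              ultimately show False using c by fastforce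
            next
              case 2
              then have m1: "m - 1 \<ge> 1" by (auto simp: rl_maxima_def)
              have "f l' < f (m - 1)" using 2 e(1,2) True ijl l'(1,2) by (auto simp: rl_maxima_def)
              moreover from this have "i' \<noteq> m - 1" using c by auto
              then have "i' < m - 1" using e(1) True ijl by linarith
              ultimately show False
                using avoidsD(1)[OF A, of i' "m - 1" l'] c e(1,2) True ijl i'(1,2) l'(1,2) m1 by auto
            qed
          qed
          moreover have "?g l \<le> Suc N" by (rule le[OF b(4,5)])
          moreover have "?g j = Suc N" using at True by simp
          ultimately show ?thesis by linarith
        next
          case jm: False
          show ?thesis
          proof (cases "Suc j = m")
            case True
            have mN: "m \<le> N" using ijl True il by auto
            have e: "i = i'" "l = Suc l'" "?g j = f j" "j = m - 1"
              using ijl True i' l' sh[of j] mN by (auto simp: shift_def split: if_splits)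
            have "\<not> (?g j < ?g l \<and> ?g l < ?g i)"
              unfolding v e(3)
            proof
              assume c: "f j < f l' \<and> f l' < f i'"
              from B mN consider "m \<in> lr_maxima N f" | "m - 1 \<in> rl_maxima N f"
                by (auto simp: active_def)
              then show False
              proof cases
                case 1
                then have "\<forall>j\<in>{1..<m}. f j < f m" by (simp add: lr_maxima_def)
                moreover have "i' \<in> {1..<m}" using i'(1) e(1) True ijl by auto
                ultimately have "f i' < f m" by blast
                moreover from this have "l' \<noteq> m" using c by auto
                ultimately show False
                  using avoidsD(2)[OF A, of i' j l'] c e(1,2) True ijl i'(1,2) l'(1,2) by auto
              next
                case 2
                then have "f l' < f j" using e(1,2,4) True ijl l'(1,2) by (auto simp: rl_maxima_def)
                then show False using c by simp
              qed
            qed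
            moreover have "?g l \<le> Suc N" by (rule le[OF b(4,5)])
            moreover have "?g (Suc j) = Suc N" using at True by simp
            ultimately show ?thesis by linarith
          next
            case False
            obtain j' where j': "1 \<le> j'" "j' \<le> N" "j = shift m j'"
              using ex_shift[OF b(7,8) jm m] .
            have sj: "Suc j = shift m (Suc j')"
              using j' jm False by (auto simp: shift_def split: if_splits)
            have "shift m (Suc j') < shift m l'" using sj ijl l' by simp
            then have jl: "Suc j' < l'" by simp
            have "shift m i' < shift m j'" using i' j' ijl by simp
            then have "i' < j'" by simp
            moreover have "?g j = f j'" "?g (Suc j) = f (Suc j')"
              using sj j' sh[of j'] sh[of "Suc j'"] jl l' by auto
            ultimately show ?thesis
              using avoidsD[OF A, of i' j' l'] v i'(1) l'(2) jl by auto
          qed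
        qed
      qed
    qed
  qed
  then show ?thesis using f ins_max_permutes[OF f m] by (simp add: baxter_avoids)
qed

text \<open>A discrete intermediate value argument; it will locate the step at which the values of a
  permutation jump past a pair of adjacent values.\<close>

lemma switch_point:
  assumes "P y" "\<not> P z" "y < (z::nat)"
  shows "\<exists>j. y \<le> j \<and> j < z \<and> P j \<and> \<not> P (Suc j)"
  using assms(3,2)
proof (induction z)
  case (Suc z)
  show ?case
  proof (cases "P z")
    case True
    with Suc.prems show ?thesis by (intro exI[of _ z]) auto
  next
    case False
    then have "y < z" using Suc.prems(1) assms(1) by (cases "y = z") auto
    with Suc.IH False show ?thesis by (meson less_Suc_eq)
  qed
qed simp

section \<open>Inserting a mirrored pair of points into an involution\<close>

text \<open>
  A pattern of the inverse is a pattern whose middle values, rather than its middle positions, are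
  adjacent; somewhere between the outer positions the values jump over that pair.
\<close>

lemma avoids_inv:
  assumes f: "f permutes {1..N}" and A: "avoids N f"
  shows "avoids N (inv f)"
  unfolding avoids_def
proof (intro allI impI)
  let ?F = "inv f"
  have eq [simp]: "f (?F x) = x" for x using permutes_inverses(1)[OF f] .
  have inj: "f x = f y \<Longrightarrow> x = y" for x y using injD[OF permutes_inj[OF f]] .
  have rng: "1 \<le> ?F x \<and> ?F x \<le> N" if "1 \<le> x" "x \<le> N" for x
    using permutes_range[OF permutes_inv[OF f] that] .
  fix i j l assume ijl: "1 \<le> i \<and> i < j \<and> Suc j < l \<and> l \<le> N"
  have r: "1 \<le> ?F (Suc j)" "?F j \<le> N" "1 \<le> ?F j" "?F (Suc j) \<le> N"
    using rng[of "Suc j"] rng[of j] ijl by auto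
  show "\<not> (?F (Suc j) < ?F i \<and> ?F i < ?F l \<and> ?F l < ?F j) \<and>
        \<not> (?F j < ?F l \<and> ?F l < ?F i \<and> ?F i < ?F (Suc j))"
  proof (intro conjI notI)
    assume c: "?F (Suc j) < ?F i \<and> ?F i < ?F l \<and> ?F l < ?F j"
    have "f (?F i) < j \<and> \<not> f (?F l) < j" "?F i < ?F l" using ijl c by auto
    then obtain t where t: "?F i \<le> t" "t < ?F l" "f t < j" "\<not> f (Suc t) < j"
      using switch_point[of "\<lambda>t. f t < j" "?F i" "?F l"] by auto
    \<comment> \<open>The values \<open>j\<close> and \<open>Suc j\<close> are taken outside the
      range of positions from \<open>?F i\<close> to \<open>?F l\<close>, so the jump after
      \<open>t\<close> passes over both. Thus \<open>Suc j\<close>, \<open>f t\<close>,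
      \<open>f (Suc t)\<close>, \<open>j\<close> form a 3-14-2.\<close>
    have "f (Suc t) \<noteq> j" "f (Suc t) \<noteq> Suc j"
      using inj[of "Suc t" "?F j"] inj[of "Suc t" "?F (Suc j)"] t c by auto
    then have "Suc j < f (Suc t)" using t(4) by linarith
    then show False
      using avoidsD(2)[OF A r(1), of t "?F j"] t c r by auto
  next
    assume c: "?F j < ?F l \<and> ?F l < ?F i \<and> ?F i < ?F (Suc j)"
    have "j < f (?F l) \<and> \<not> j < f (?F i)" "?F l < ?F i" using ijl c by auto
    then obtain t where t: "?F l \<le> t" "t < ?F i" "j < f t" "\<not> j < f (Suc t)"
      using switch_point[of "\<lambda>t. j < f t" "?F l" "?F i"] by auto
    have "f (Suc t) \<noteq> j" "f t \<noteq> Suc j"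
      using inj[of "Suc t" "?F j"] inj[of t "?F (Suc j)"] t c by auto
    then have "f (Suc t) < j" "Suc j < f t" using t(3,4) by linarith+
    then show False
      using avoidsD(1)[OF A r(3), of t "?F (Suc j)"] t c r by auto
  qed
qed

lemma baxter_inv: "baxter N f \<Longrightarrow> baxter N (inv f)"
  by (simp add: baxter_avoids avoids_inv permutes_inv)

definition involution :: "nat \<Rightarrow> (nat \<Rightarrow> nat) \<Rightarrow> bool" where
  "involution N f \<longleftrightarrow> (\<forall>x. f (f x) = x) \<and> (\<forall>x. x \<notin> {1..N} \<longrightarrow> f x = x)"

lemma involution_iff: "involution N f \<longleftrightarrow> f permutes {1..N} \<and> involutive f"
proof
  assume i: "involution N f"
  then have ff: "f (f x) = x" for x by (simp add: involution_def)
  have "\<exists>!x. f x = y" for y using ff by metis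
  then have "f permutes {1..N}" using i by (auto simp: permutes_def involution_def)
  moreover have "inv f = f" using ff by (intro inv_unique_comp) auto
  ultimately show "f permutes {1..N} \<and> involutive f" by (simp add: involutive_def)
next
  assume "f permutes {1..N} \<and> involutive f"
  then show "involution N f"
    using permutes_inverses(1)[of f] permutes_not_in[of f]
    by (metis involution_def involutive_def)
qed

lemma involutionD:
  assumes "involution N f"
  shows "f (f x) = x" "f permutes {1..N}" "inv f = f" "f x = f y \<longleftrightarrow> x = y"
    "x = 0 \<or> N < x \<Longrightarrow> f x = x" "1 \<le> x \<Longrightarrow> x \<le> N \<Longrightarrow> 1 \<le> f x \<and> f x \<le> N"
proof -
  show "f (f x) = x" using assms by (simp add: involution_def)
  show p: "f permutes {1..N}" "inv f = f"
    using assms by (simp_all add: involution_iff involutive_def)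
  show "f x = f y \<longleftrightarrow> x = y" using assms by (metis involution_def)
  show "x = 0 \<or> N < x \<Longrightarrow> f x = x" using assms by (auto simp: involution_def)
  show "1 \<le> x \<Longrightarrow> x \<le> N \<Longrightarrow> 1 \<le> f x \<and> f x \<le> N" using permutes_range[OF p(1)] .
qed

text \<open>Adds the points \<open>(m, N + 2)\<close> and \<open>(N + 2, m)\<close>; for
  \<open>m = Suc N\<close> they form an adjacent transposition at the end. Building the pair in two
  stages lets the criterion for a new maximum be applied twice.\<close>

definition ins_pair :: "nat \<Rightarrow> nat \<Rightarrow> (nat \<Rightarrow> nat) \<Rightarrow> nat \<Rightarrow> nat" where
  "ins_pair N m f = ins_max (Suc N) m (ins_last N m f)"

lemma ins_pair_simps:
  "x \<le> N \<Longrightarrow> m \<le> Suc N \<Longrightarrow> ins_pair N m f (shift m x) = shift m (f x)"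
  "ins_pair N m f m = Suc (Suc N)"
  "m \<le> Suc N \<Longrightarrow> ins_pair N m f (Suc (Suc N)) = m"
  "m \<le> Suc N \<Longrightarrow> Suc (Suc N) < x \<Longrightarrow> ins_pair N m f x = x"
  by (auto simp: ins_pair_def ins_max_def ins_last_def shift_def)

lemma ins_pair_0: "1 \<le> m \<Longrightarrow> f 0 = 0 \<Longrightarrow> ins_pair N m f 0 = 0"
  by (simp add: ins_pair_def ins_max_def ins_last_def shift_def)

lemma ins_pair_involution:
  assumes f: "involution N f" and m: "1 \<le> m" "m \<le> Suc N"
  shows "involution (Suc (Suc N)) (ins_pair N m f)"
  unfolding involution_def
proof (intro conjI allI impI)
  let ?g = "ins_pair N m f"
  note s = ins_pair_simps[where N = N and m = m and f = f]
  have z: "?g 0 = 0" using ins_pair_0 involutionD(5)[OF f] m by simp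
  fix x
  show "?g x = x" if "x \<notin> {1..Suc (Suc N)}"
  proof -
    have "x = 0 \<or> Suc (Suc N) < x" using that by auto
    then show ?thesis using s(4) m z by auto
  qed
  consider "x = 0" | "Suc (Suc N) < x" | "x = m" | "x = Suc (Suc N)"
    | "1 \<le> x" "x \<le> Suc N" "x \<noteq> m" by linarith
  then show "?g (?g x) = x"
  proof cases
    case 5
    obtain y where "1 \<le> y" "y \<le> N" "x = shift m y" using ex_shift[OF 5 m] .
    then show ?thesis using s(1) m involutionD(1,6)[OF f, of y] by auto
  qed (use z s m in auto)
qed

lemma ins_pair_inj:
  assumes f: "involution N f" "involution N f'" and m: "m \<le> Suc N" "m' \<le> Suc N"
    and e: "ins_pair N m f = ins_pair N m' f'"
  shows "m = m' \<and> f = f'"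
proof
  show mm: "m = m'" using ins_pair_simps(3) m e by metis
  show "f = f'"
  proof
    fix x show "f x = f' x"
    proof (cases "x \<le> N")
      case True
      then have "shift m (f x) = shift m (f' x)"
        using ins_pair_simps(1)[of x N m] m e mm by metis
      then show ?thesis by simp
    next
      case False
      then show ?thesis using involutionD(5)[OF f(1)] involutionD(5)[OF f(2)] by simp
    qed
  qed
qed

lemma involution_last_fixed:
  assumes "involution (Suc N) g" "g (Suc N) = Suc N"
  shows "involution N g"
  unfolding involution_def
proof (intro conjI allI impI)
  fix x
  show "g (g x) = x" using involutionD(1)[OF assms(1)] .
  show "g x = x" if "x \<notin> {1..N}"
    using that assms(2) involutionD(5)[OF assms(1), of x] by (cases "x = Suc N") auto
qed

lemma ex_ins_pair:
  assumes g: "involution N g" and ne: "g N \<noteq> N"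
  obtains M m f where "N = Suc (Suc M)" "1 \<le> m" "m \<le> Suc M" "involution M f" "g = ins_pair M m f"
proof -
  define m where "m = g N"
  have N1: "1 \<le> N" using ne involutionD(5)[OF g, of N] by (cases N) auto
  have m: "1 \<le> m" "m \<le> N" "m \<noteq> N" "g m = N"
    using involutionD(1,6)[OF g, of N] N1 ne by (auto simp: m_def)
  then obtain M where M: "N = Suc (Suc M)" by (cases N; cases "N - 1") auto
  have mM: "m \<le> Suc M" using m M by auto
  \<comment> \<open>\<open>d\<close> closes the gap at \<open>m\<close>, undoing
    \<open>shift m\<close>; it serves to delete the points \<open>(m, N)\<close> and
    \<open>(N, m)\<close> of \<open>g\<close>.\<close>
  define d where "d y = (if y < m then y else y - 1)" for y
  have d: "d (shift m x) = x" for x by (simp add: d_def shift_def)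
  define f where "f x = (if x \<in> {1..M} then d (g (shift m x)) else x)" for x
  have key: "1 \<le> f x \<and> f x \<le> M \<and> g (shift m x) = shift m (f x)" if x: "1 \<le> x" "x \<le> M" for x
  proof -
    have b: "1 \<le> shift m x" "shift m x \<le> N" "shift m x \<noteq> N" "shift m x \<noteq> m"
      using x M by (auto simp: shift_def)
    have n: "g (shift m x) \<noteq> N" "g (shift m x) \<noteq> m"
      using b involutionD(4)[OF g] m(4) m_def by metis+
    have "1 \<le> g (shift m x)" "g (shift m x) \<le> Suc M"
      using involutionD(6)[OF g b(1,2)] n M by auto
    then obtain y where "1 \<le> y" "y \<le> M" "g (shift m x) = shift m y"
      using ex_shift[OF _ _ n(2) m(1) mM] by metis
    then show ?thesis using x by (simp add: f_def d)
  qed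
  have "involution M f"
    unfolding involution_def
  proof (intro conjI allI impI)
    fix x
    show "f (f x) = x"
    proof (cases "x \<in> {1..M}")
      case True
      then have "f (f x) = d (g (g (shift m x)))" using key[of x] by (simp add: f_def)
      then show ?thesis using involutionD(1)[OF g] d by simp
    next
      case False
      then have "f x = x" by (auto simp: f_def)
      then show ?thesis by simp
    qed
  qed (auto simp: f_def)
  moreover have "g = ins_pair M m f"
  proof
    fix x
    consider "x = 0" | "Suc (Suc M) < x" | "x = m" | "x = Suc (Suc M)"
      | "1 \<le> x" "x \<le> Suc M" "x \<noteq> m" by linarith
    then show "g x = ins_pair M m f x"
    proof cases
      case 1
      then show ?thesis using involutionD(5)[OF g, of 0] ins_pair_0[OF m(1), of f M] by (simp add: f_def)
    next
      case 5
      obtain y where "1 \<le> y" "y \<le> M" "x = shift m y" using ex_shift[OF 5 m(1) mM] .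
      then show ?thesis using key ins_pair_simps(1) mM by simp
    qed (use ins_pair_simps mM m(4) m_def M involutionD(5)[OF g] in auto)
  qed
  ultimately show ?thesis using that M m(1) mM by blast
qed

text \<open>Inversion reflects the graph in the diagonal, which preserves the graph of an involution
  and turns the point \<open>(m, N + 1)\<close> into \<open>(N + 1, m)\<close>.\<close>

lemma inv_ins_max:
  assumes f: "involution N f" and m: "1 \<le> m" "m \<le> Suc N"
  shows "inv (ins_max N m f) = ins_last N m f" "inv (ins_last N m f) = ins_max N m f"
proof -
  have *: "ins_last N m f (ins_max N m f x) = x" for x
  proof -
    consider "x = 0" | "Suc N < x" | "x = m" | "1 \<le> x" "x \<le> Suc N" "x \<noteq> m" by linarith
    then show ?thesis
    proof cases
      case 4
      obtain y where y: "1 \<le> y" "y \<le> N" "x = shift m y" using ex_shift[OF 4 m] .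
      then show ?thesis using involutionD(1,6)[OF f, of y] by (simp add: ins_max_shift ins_last_def)
    qed (use m involutionD(5)[OF f, of 0] in \<open>auto simp: ins_max_def ins_last_def shift_def\<close>)
  qed
  have b: "bij (ins_max N m f)"
    using ins_max_permutes[OF involutionD(2)[OF f] m] permutes_bij by blast
  show i: "inv (ins_max N m f) = ins_last N m f"
  proof
    fix y
    obtain x where "y = ins_max N m f x" using b by (metis bij_pointE)
    then show "inv (ins_max N m f) y = ins_last N m f y"
      using * b by (simp add: bij_is_inj)
  qed
  show "inv (ins_last N m f) = ins_max N m f"
    using inv_inv_eq[OF b] i by simp
qed

section \<open>The places where a mirrored pair may be inserted\<close>

definition ra_maxima :: "nat \<Rightarrow> (nat \<Rightarrow> nat) \<Rightarrow> nat set" where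
  "ra_maxima N f = {i \<in> rl_maxima N f. i < f i}"

definition sites :: "nat \<Rightarrow> (nat \<Rightarrow> nat) \<Rightarrow> nat set" where
  "sites N f = lr_maxima N f \<union> Suc ` ra_maxima N f \<union> {Suc N}"

text \<open>The place \<open>m\<close> must be active before and after the value \<open>m\<close> is
  appended at the end. The appended value leaves the left-to-right maxima in place but hides the
  right-to-left maxima of value below \<open>m\<close>. Position \<open>m - 1\<close> survives iff
  \<open>m \<le> f (m - 1)\<close>, that is, iff it is strictly above the diagonal.\<close>

lemma sites_active_iff:
  assumes f: "involution N f" and m: "1 \<le> m" "m \<le> Suc N"
  shows "active N f m \<and> active (Suc N) (ins_last N m f) m \<longleftrightarrow> m \<in> sites N f"
proof -
  let ?h = "ins_last N m f"
  have h: "?h x = shift m (f x)" if "x \<le> N" for x using that by (simp add: ins_last_def)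
  have hN: "?h (Suc N) = m" by (simp add: ins_last_def)
  have rng: "f x \<le> N" if "x \<le> N" for x
    using involutionD(5)[OF f, of x] involutionD(6)[OF f, of x] that by (cases "x = 0") auto
  consider "m = Suc N" | "m \<le> N" using m by linarith
  then show ?thesis
  proof cases
    case 1
    then have "m \<in> lr_maxima (Suc N) ?h"
      using rng by (auto simp: lr_maxima_def ins_last_def less_Suc_eq_le shift_def)
    then show ?thesis using 1 by (simp add: active_def sites_def)
  next
    case 2
    have L: "m \<in> lr_maxima (Suc N) ?h \<longleftrightarrow> m \<in> lr_maxima N f"
      using 2 m by (auto simp: lr_maxima_def h)
    have R: "m - 1 \<in> rl_maxima (Suc N) ?h \<longleftrightarrow> m - 1 \<in> rl_maxima N f \<and> m \<le> f (m - 1)"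
    proof -
      have "{m - 1<..Suc N} = insert (Suc N) {m - 1<..N}" using 2 m by auto
      then show ?thesis using 2 m by (auto simp: rl_maxima_def h hN)
    qed
    have "m \<in> Suc ` ra_maxima N f \<longleftrightarrow> m - 1 \<in> rl_maxima N f \<and> m \<le> f (m - 1)"
      using m by (auto simp: ra_maxima_def image_iff intro!: bexI[of _ "m - 1"])
    then show ?thesis using 2 L R by (auto simp: active_def sites_def)
  qed
qed

text \<open>The criterion for a new maximum is used once on \<open>ins_last N m f\<close> and once
  on \<open>ins_max N m f\<close>; these are inverse to each other, hence Baxter
  simultaneously.\<close>

lemma ins_pair_baxter_iff:
  assumes f: "involution N f" and m: "1 \<le> m" "m \<le> Suc N"
  shows "baxter (Suc (Suc N)) (ins_pair N m f) \<longleftrightarrow> baxter N f \<and> m \<in> sites N f"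
proof -
  have i: "inv (ins_max N m f) = ins_last N m f" "inv (ins_last N m f) = ins_max N m f"
    using inv_ins_max[OF f m] by auto
  have "ins_last N m f permutes {1..Suc N}"
    using permutes_inv[OF ins_max_permutes[OF involutionD(2)[OF f] m]] i by simp
  then have "baxter (Suc (Suc N)) (ins_pair N m f) \<longleftrightarrow>
      baxter (Suc N) (ins_last N m f) \<and> active (Suc N) (ins_last N m f) m"
    unfolding ins_pair_def using m by (intro ins_max_baxter_iff) auto
  also have "baxter (Suc N) (ins_last N m f) \<longleftrightarrow> baxter (Suc N) (ins_max N m f)"
    using baxter_inv i by metis
  also have "\<dots> \<longleftrightarrow> baxter N f \<and> active N f m"
    using ins_max_baxter_iff[OF involutionD(2)[OF f] m] .
  finally show ?thesis using sites_active_iff[OF f m] by blast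
qed

text \<open>Appending a fixed point is inserting a maximum at the last place, always active; the
  function itself does not change.\<close>

lemma baxter_Suc_fixed:
  assumes "involution N f"
  shows "baxter (Suc N) f \<longleftrightarrow> baxter N f"
proof -
  have "ins_max N (Suc N) f = f"
    using involutionD(5)[OF assms] by (auto simp: ins_max_def fun_eq_iff)
  then show ?thesis
    using ins_max_baxter_iff[OF involutionD(2)[OF assms], of "Suc N"] by (simp add: active_def)
qed

section \<open>Statistics of the generating tree\<close>

lemma maxima_subset:
  "lr_maxima N f \<subseteq> {1..N}" "rl_maxima N f \<subseteq> {1..N}" "ra_maxima N f \<subseteq> {1..N}"
  by (auto simp: lr_maxima_def rl_maxima_def ra_maxima_def)

lemma maxima_finite [simp]: "finite (lr_maxima N f)" "finite (ra_maxima N f)"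
  using finite_subset[OF maxima_subset(1)] finite_subset[OF maxima_subset(3)] by simp_all

lemma lr_maxima_ins_pair:
  assumes f: "involution N f" and m: "1 \<le> m" "m \<le> Suc N"
  shows "lr_maxima (Suc (Suc N)) (ins_pair N m f) = insert m {i \<in> lr_maxima N f. i < m}"
proof -
  let ?g = "ins_pair N m f"
  have g: "?g x = shift m (f x)" if "x < m" for x
    using ins_pair_simps(1)[of x N m f] that m by (simp add: shift_def)
  have gm: "?g m = Suc (Suc N)" by (rule ins_pair_simps)
  have le: "?g x < Suc (Suc N)" if "x < m" for x
    using g[OF that] that m involutionD(5,6)[OF f, of x] by (cases "x = 0") (auto simp: shift_def)
  have hi: "?g x \<le> Suc (Suc N)" if "x \<le> Suc (Suc N)" for x
    using involutionD(5,6)[OF ins_pair_involution[OF f m], of x] that by (cases "x = 0") auto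
  show ?thesis
  proof (rule set_eqI)
    fix i
    consider "i < m" | "i = m" | "m < i" by linarith
    then show "i \<in> lr_maxima (Suc (Suc N)) ?g \<longleftrightarrow> i \<in> insert m {i \<in> lr_maxima N f. i < m}"
    proof cases
      case 1
      then show ?thesis using m g by (auto simp: lr_maxima_def)
    next
      case 2
      then show ?thesis using m le gm by (auto simp: lr_maxima_def)
    next
      case 3
      have "i \<notin> lr_maxima (Suc (Suc N)) ?g"
      proof
        assume "i \<in> lr_maxima (Suc (Suc N)) ?g"
        then have "?g m < ?g i" "i \<le> Suc (Suc N)"
          using 3 m by (auto simp: lr_maxima_def)
        then show False using hi[of i] gm by simp
      qed
      then show ?thesis using 3 by auto
    qed
  qed
qed

text \<open>The new maximum hides everything to its left. A position \<open>v \<ge> m\<close> in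
  \<open>ra_maxima N f\<close> satisfies \<open>m \<le> v < f v\<close>, so the new last value
  \<open>m\<close> does not hide it; it moves one place to the right and stays above the
  diagonal.\<close>

lemma ra_maxima_ins_pair:
  assumes f: "involution N f" and m: "1 \<le> m" "m \<le> Suc N"
  shows "ra_maxima (Suc (Suc N)) (ins_pair N m f) = insert m (Suc ` {v \<in> ra_maxima N f. m \<le> v})"
proof -
  let ?g = "ins_pair N m f"
  have g: "?g (Suc x) = shift m (f x)" if "m \<le> x" "x \<le> N" for x
    using ins_pair_simps(1)[of x N m f] that m by (simp add: shift_def)
  have gm: "?g m = Suc (Suc N)" by (rule ins_pair_simps)
  have gl: "?g (Suc (Suc N)) = m" using m ins_pair_simps by simp
  have hi: "?g x \<le> Suc (Suc N)" if "x \<le> Suc (Suc N)" for x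
    using involutionD(5,6)[OF ins_pair_involution[OF f m], of x] that by (cases "x = 0") auto
  have ne: "?g x \<noteq> Suc (Suc N)" if "x \<noteq> m" for x
    using involutionD(4)[OF ins_pair_involution[OF f m], of x m] gm that by simp
  show ?thesis
  proof (rule set_eqI)
    fix i
    consider "i < m" | "i = m" | "Suc N < i" "i \<noteq> m" | "m < i" "i \<le> Suc N" by linarith
    then show "i \<in> ra_maxima (Suc (Suc N)) ?g \<longleftrightarrow>
        i \<in> insert m (Suc ` {v \<in> ra_maxima N f. m \<le> v})"
    proof cases
      case 1
      have "i \<notin> ra_maxima (Suc (Suc N)) ?g"
      proof
        assume "i \<in> ra_maxima (Suc (Suc N)) ?g"
        then have "?g m < ?g i" "i \<le> Suc (Suc N)"
          using 1 m by (auto simp: ra_maxima_def rl_maxima_def)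
        then show False using hi[of i] gm by simp
      qed
      then show ?thesis using 1 by auto
    next
      case 2
      have "?g j < Suc (Suc N)" if "m < j" "j \<le> Suc (Suc N)" for j
        using hi[of j] ne[of j] that by (simp add: order_le_neq_trans)
      then show ?thesis using 2 m gm by (auto simp: ra_maxima_def rl_maxima_def)
    next
      case 3
      then have "i \<notin> ra_maxima (Suc (Suc N)) ?g"
        using gl m by (cases "i = Suc (Suc N)") (auto simp: ra_maxima_def rl_maxima_def)
      then show ?thesis using 3 maxima_subset(3)[of N f] by auto
    next
      case 4
      then obtain v where v: "i = Suc v" "m \<le> v" "v \<le> N" by (cases i) auto
      have "Suc ` {v<..N} = {i<..Suc N}"
        using v by (simp add: atLeastSucAtMost_greaterThanAtMost[symmetric])
      then have I: "{i<..Suc (Suc N)} = insert (Suc (Suc N)) (Suc ` {v<..N})"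
        using v by auto
      have "i < ?g i \<longleftrightarrow> v < f v" using v by (auto simp: g shift_def)
      moreover have "(\<forall>j\<in>{i<..Suc (Suc N)}. ?g j < ?g i) \<longleftrightarrow>
          m \<le> f v \<and> (\<forall>j\<in>{v<..N}. f j < f v)"
        unfolding I using v by (auto simp: g gl)
      ultimately have "i \<in> ra_maxima (Suc (Suc N)) ?g \<longleftrightarrow> v \<in> ra_maxima N f"
        using v m by (auto simp: ra_maxima_def rl_maxima_def)
      then show ?thesis using v by auto
    qed
  qed
qed

lemma fixed_points_ins_pair:
  assumes f: "involution N f" and m: "1 \<le> m" "m \<le> Suc N"
  shows "card (fixed_points (Suc (Suc N)) (ins_pair N m f)) = card (fixed_points N f)"
proof -
  have "fixed_points (Suc (Suc N)) (ins_pair N m f) = shift m ` fixed_points N f"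
  proof (rule set_eqI)
    fix x
    consider "x = 0 \<or> Suc (Suc N) < x" | "x = m" | "x = Suc (Suc N)"
      | "1 \<le> x" "x \<le> Suc N" "x \<noteq> m" by linarith
    then show "x \<in> fixed_points (Suc (Suc N)) (ins_pair N m f) \<longleftrightarrow> x \<in> shift m ` fixed_points N f"
    proof cases
      case 4
      then obtain y where y: "1 \<le> y" "y \<le> N" "x = shift m y" using ex_shift[OF 4 m] by blast
      then show ?thesis
        using ins_pair_simps(1)[of y N m f] m 4 by (auto simp: fixed_points_def image_iff)
    qed (use m ins_pair_simps in \<open>auto simp: fixed_points_def shift_def\<close>)
  qed
  moreover have "inj_on (shift m) (fixed_points N f)" by (auto intro: inj_onI)
  ultimately show ?thesis by (simp add: card_image)
qed

section \<open>Descents; the flag \<open>c\<close> treats crossing and non-crossing ones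
  together\<close>

definition descs :: "bool \<Rightarrow> nat \<Rightarrow> (nat \<Rightarrow> nat) \<Rightarrow> nat set" where
  "descs c N f = {i \<in> descents N f. crosses_diagonal f i = c}"

lemma descs_iff: "i \<in> descs c N f \<longleftrightarrow>
    1 \<le> i \<and> i < N \<and> f (Suc i) < f i \<and> (i < f i \<and> f (Suc i) < Suc i \<longleftrightarrow> c)"
  by (auto simp: descs_def descents_def crosses_diagonal_def)

lemma descs_finite [simp]: "finite (descs c N f)"
  by (rule finite_subset[of _ "{1..N}"]) (auto simp: descs_iff)

text \<open>Besides the inherited descents there is one just after the new maximum, and possibly one
  from the old last value down to \<open>m\<close>; the latter starts at \<open>Suc N\<close> with a
  value at most \<open>Suc N\<close>, so it never crosses. A descent at \<open>m - 1\<close> is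
  lost, as position \<open>m - 1\<close> is now followed by the maximum.\<close>

lemma descs_ins_pair:
  assumes f: "involution N f" and m: "1 \<le> m" "m \<le> Suc N"
  shows "descs c (Suc (Suc N)) (ins_pair N m f) =
    {i \<in> descs c N f. Suc i < m} \<union> Suc ` {i \<in> descs c N f. m \<le> i}
    \<union> {i. i = m \<and> (if m \<le> N then f m < m \<longleftrightarrow> c else c)} \<union> {i. i = Suc N \<and> m \<le> N \<and> m \<le> f N \<and> \<not> c}"
proof -
  let ?g = "ins_pair N m f"
  have g1: "?g x = shift m (f x)" if "x < m" for x
    using ins_pair_simps(1)[of x N m f] that m by (simp add: shift_def)
  have g: "?g (Suc x) = shift m (f x)" if "m \<le> x" "x \<le> N" for x
    using ins_pair_simps(1)[of x N m f] that m by (simp add: shift_def)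
  have gm: "?g m = Suc (Suc N)" by (rule ins_pair_simps)
  have gl: "?g (Suc (Suc N)) = m" using m ins_pair_simps by simp
  have rng: "f x \<le> N" if "x \<le> N" for x
    using involutionD(5,6)[OF f, of x] that by (cases "x = 0") auto
  show ?thesis
  proof (rule set_eqI)
    fix i
    let ?R = "i \<in> {i \<in> descs c N f. Suc i < m} \<union> Suc ` {i \<in> descs c N f. m \<le> i}
      \<union> {i. i = m \<and> (if m \<le> N then f m < m \<longleftrightarrow> c else c)} \<union> {i. i = Suc N \<and> m \<le> N \<and> m \<le> f N \<and> \<not> c}"
    consider "Suc i < m" | "Suc i = m" | "i = m" "m \<le> N" | "i = m" "m = Suc N"
      | "i = Suc N" "m \<le> N" | "Suc N < i" | "m < i" "i \<le> N" using m by linarith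
    then show "i \<in> descs c (Suc (Suc N)) ?g \<longleftrightarrow> ?R"
    proof cases
      case 1
      have "?R \<longleftrightarrow> i \<in> descs c N f" using 1 m by auto
      moreover have "i < shift m (f i) \<longleftrightarrow> i < f i" "shift m (f (Suc i)) < Suc i \<longleftrightarrow> f (Suc i) < Suc i"
        using 1 by (auto simp: shift_def)
      ultimately show ?thesis using 1 m by (auto simp: descs_iff g1)
    next
      case 2
      then have "?g i \<le> Suc (Suc N)" using rng[of i] m by (auto simp: g1 shift_def)
      then show ?thesis using 2 m gm by (auto simp: descs_iff)
    next
      case 3
      then show ?thesis
        using m rng[of m] g[of m] gm by (auto simp: descs_iff shift_def)
    next
      case 4
      then show ?thesis using gm gl by (auto simp: descs_iff)
    next
      case 5
      then show ?thesis
        using g[of N] gl rng[of N] by (auto simp: descs_iff shift_def)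
    next
      case 6
      then show ?thesis using m by (auto simp: descs_iff)
    next
      case 7
      then obtain j where j: "i = Suc j" "m \<le> j" "j < N" by (cases i) auto
      then have R: "?R \<longleftrightarrow> j \<in> descs c N f" by auto
      have "?g i = shift m (f j)" "?g (Suc i) = shift m (f (Suc j))"
        using g[of j] g[of "Suc j"] j by auto
      moreover have "i < shift m (f j) \<longleftrightarrow> j < f j"
        "shift m (f (Suc j)) < Suc i \<longleftrightarrow> f (Suc j) < Suc j"
        using j by (auto simp: shift_def)
      ultimately show ?thesis using j m unfolding R by (auto simp: descs_iff)
    qed
  qed
qed

lemma card_Un4_disjoint:
  assumes "finite A" "finite B" "finite C" "finite D"
    and "A \<inter> B = {}" "A \<inter> C = {}" "A \<inter> D = {}" "B \<inter> C = {}" "B \<inter> D = {}" "C \<inter> D = {}"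
  shows "card (A \<union> B \<union> C \<union> D) = card A + card B + card C + card D"
  using assms by (simp add: card_Un_disjoint Int_Un_distrib2)

lemma card_descs_split:
  "card (descs c N f) = card {i \<in> descs c N f. i < m} + card {i \<in> descs c N f. Suc m \<le> i}
    + card (descs c N f \<inter> {m})"
proof -
  have "descs c N f = {i \<in> descs c N f. i < m} \<union> {i \<in> descs c N f. Suc m \<le> i}
      \<union> (descs c N f \<inter> {m}) \<union> {}" (is "_ = ?U")
  proof (rule set_eqI)
    fix x show "x \<in> descs c N f \<longleftrightarrow> x \<in> ?U"
      by (cases x m rule: linorder_cases) auto
  qed
  then have "card (descs c N f) = card ?U" by (rule arg_cong)
  also have "card ?U = card {i \<in> descs c N f. i < m} + card {i \<in> descs c N f. Suc m \<le> i}
      + card (descs c N f \<inter> {m}) + card ({} :: nat set)"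
    by (intro card_Un4_disjoint) auto
  finally show ?thesis by (simp only: card.empty add_0_right)
qed

lemma card_descs_ins_pair:
  assumes f: "involution N f" and m: "1 \<le> m" "m \<le> Suc N"
  shows "card (descs c (Suc (Suc N)) (ins_pair N m f)) + (if m - 1 \<in> descs c N f then 1 else 0)
    = card (descs c N f) + (if (if m \<le> N then f m < m \<longleftrightarrow> c else c) then 1 else 0)
    + (if m \<le> N \<and> m \<le> f N \<and> \<not> c then 1 else 0)"
proof -
  have "card (descs c (Suc (Suc N)) (ins_pair N m f)) =
     card {i \<in> descs c N f. Suc i < m} + card (Suc ` {i \<in> descs c N f. m \<le> i})
    + card {i. i = m \<and> (if m \<le> N then f m < m \<longleftrightarrow> c else c)}
    + card {i. i = Suc N \<and> m \<le> N \<and> m \<le> f N \<and> \<not> c}"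
    unfolding descs_ins_pair[OF assms]
    using m by (intro card_Un4_disjoint) (auto simp: descs_iff)
  also have "card (Suc ` {i \<in> descs c N f. m \<le> i}) = card {i \<in> descs c N f. m \<le> i}"
    by (simp add: card_image)
  finally have "card (descs c (Suc (Suc N)) (ins_pair N m f)) =
      card {i \<in> descs c N f. Suc i < m} + card {i \<in> descs c N f. m \<le> i}
    + (if (if m \<le> N then f m < m \<longleftrightarrow> c else c) then 1 else 0)
    + (if m \<le> N \<and> m \<le> f N \<and> \<not> c then 1 else 0)"
    by (simp only: Collect_conv_if card.empty card_1_singleton_iff split: if_split) simp
  note g = this
  have e: "{i \<in> descs c N f. i < m - 1} = {i \<in> descs c N f. Suc i < m}"
    "{i \<in> descs c N f. Suc (m - 1) \<le> i} = {i \<in> descs c N f. m \<le> i}" using m by auto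
  have "card (descs c N f \<inter> {m - 1}) = (if m - 1 \<in> descs c N f then 1 else 0)"
    by simp
  note split = card_descs_split[of c N f "m - 1", unfolded e this]
  have "u + x = v + y + z" if "u = k + l + y + z" "v = k + l + x" for u v k l x y z :: nat
    using that by simp
  from this[OF g split] show ?thesis .
qed

text \<open>There is no descent at \<open>m - 1\<close> to lose, and both possible new descents
  occur without crossing because \<open>m \<le> f m\<close> and \<open>m \<le> f N\<close>. No
  position in \<open>ra_maxima N f\<close> lies left of \<open>m\<close>, so all of them
  survive.\<close>

lemma site_lr_maximum:
  assumes f: "involution N f" and m: "m \<in> lr_maxima N f"
  shows "card (lr_maxima (Suc (Suc N)) (ins_pair N m f)) = card {i \<in> lr_maxima N f. i \<le> m}"
    "card (ra_maxima (Suc (Suc N)) (ins_pair N m f)) = Suc (card (ra_maxima N f))"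
    "card (descs False (Suc (Suc N)) (ins_pair N m f)) = card (descs False N f) + 2"
    "card (descs True (Suc (Suc N)) (ins_pair N m f)) = card (descs True N f)"
proof -
  have m1: "1 \<le> m" "m \<le> N" "m \<le> Suc N" and M: "\<forall>j\<in>{1..<m}. f j < f m"
    using m by (auto simp: lr_maxima_def)
  have "insert m {i \<in> lr_maxima N f. i < m} = {i \<in> lr_maxima N f. i \<le> m}"
    using m by auto
  then show "card (lr_maxima (Suc (Suc N)) (ins_pair N m f)) = card {i \<in> lr_maxima N f. i \<le> m}"
    using lr_maxima_ins_pair[OF f m1(1,3)] by simp
  have "m \<le> v" if "v \<in> ra_maxima N f" for v
  proof (rule ccontr)
    assume "\<not> m \<le> v"
    then have "v \<in> {1..<m}" "m \<in> {v<..N}" "\<forall>j\<in>{v<..N}. f j < f v"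
      using that m1 by (auto simp: ra_maxima_def rl_maxima_def)
    with M show False by fastforce
  qed
  then have "{v \<in> ra_maxima N f. m \<le> v} = ra_maxima N f" by auto
  moreover have "m \<notin> Suc ` ra_maxima N f" using \<open>\<And>v. v \<in> ra_maxima N f \<Longrightarrow> m \<le> v\<close> by force
  ultimately show "card (ra_maxima (Suc (Suc N)) (ins_pair N m f)) = Suc (card (ra_maxima N f))"
    using ra_maxima_ins_pair[OF f m1(1,3)] by (simp add: card_image)
  have "m - 1 \<notin> descs c N f" for c
  proof
    assume "m - 1 \<in> descs c N f"
    then have "m - 1 \<in> {1..<m}" "f m < f (m - 1)" using m1 by (auto simp: descs_iff)
    with M show False by fastforce
  qed
  \<comment> \<open>The \<open>m - 1\<close> entries to the left are distinct positive values below
    \<open>f m\<close>.\<close>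
  moreover have "m \<le> f m"
  proof -
    have "1 \<le> f j" if "1 \<le> j" "j < m" for j using involutionD(6)[OF f, of j] that m1 by auto
    then have "f ` {1..<m} \<subseteq> {1..<f m}" using M by auto
    then have "card (f ` {1..<m}) \<le> card {1..<f m}" by (intro card_mono) auto
    moreover have "inj_on f {1..<m}" using involutionD(4)[OF f] by (auto intro: inj_onI)
    ultimately have "m - 1 \<le> f m - 1" by (simp add: card_image)
    then show ?thesis using involutionD(6)[OF f m1(1,2)] by linarith
  qed
  \<comment> \<open>Otherwise the largest value \<open>N\<close> would stand at the position
    \<open>f N\<close>, to the left of the left-to-right maximum \<open>m\<close>.\<close>
  moreover have "m \<le> f N"
  proof (rule ccontr)
    assume "\<not> m \<le> f N"
    then have "f N \<in> {1..<m}" using involutionD(6)[OF f, of N] m1 by auto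
    then have "f (f N) < f m" using M by blast
    then show False using involutionD(1)[OF f, of N] involutionD(6)[OF f m1(1,2)] by simp
  qed
  ultimately show "card (descs False (Suc (Suc N)) (ins_pair N m f)) = card (descs False N f) + 2"
    "card (descs True (Suc (Suc N)) (ins_pair N m f)) = card (descs True N f)"
    using card_descs_ins_pair[OF f m1(1,3), of False] card_descs_ins_pair[OF f m1(1,3), of True] m1
    by simp_all
qed

text \<open>The descent at \<open>v\<close> is lost and the one after the new maximum replaces it;
  since \<open>v < f v\<close>, both cross under the same condition
  \<open>f (Suc v) < Suc v\<close>. There is no descent at the end, as
  \<open>Suc v \<le> f N\<close> would put the value \<open>N\<close> to the right of the
  right-to-left maximum \<open>v\<close>.\<close>

lemma site_ra_maximum:
  assumes f: "involution N f" and v: "v \<in> ra_maxima N f"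
  shows "card (lr_maxima (Suc (Suc N)) (ins_pair N (Suc v) f)) = Suc (card (lr_maxima N f))"
    "card (ra_maxima (Suc (Suc N)) (ins_pair N (Suc v) f)) = Suc (card {u \<in> ra_maxima N f. v < u})"
    "card (descs c (Suc (Suc N)) (ins_pair N (Suc v) f)) = card (descs c N f)"
proof -
  have v1: "1 \<le> v" "v \<le> N" "v < f v" and M: "\<forall>j\<in>{v<..N}. f j < f v"
    using v by (auto simp: ra_maxima_def rl_maxima_def)
  have fv: "f v \<le> N" using involutionD(6)[OF f v1(1,2)] by simp
  have m: "1 \<le> Suc v" "Suc v \<le> Suc N" "Suc v \<le> N" using v1 fv by auto
  have "i < Suc v" if "i \<in> lr_maxima N f" for i
  proof (rule ccontr)
    assume "\<not> i < Suc v"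
    then have "i \<in> {v<..N}" "v \<in> {1..<i}" "\<forall>j\<in>{1..<i}. f j < f i"
      using that v1 by (auto simp: lr_maxima_def)
    with M show False by fastforce
  qed
  then have "{i \<in> lr_maxima N f. i < Suc v} = lr_maxima N f" "Suc v \<notin> lr_maxima N f" by auto
  then show "card (lr_maxima (Suc (Suc N)) (ins_pair N (Suc v) f)) = Suc (card (lr_maxima N f))"
    using lr_maxima_ins_pair[OF f m(1,2)] by simp
  show "card (ra_maxima (Suc (Suc N)) (ins_pair N (Suc v) f)) = Suc (card {u \<in> ra_maxima N f. v < u})"
    using ra_maxima_ins_pair[OF f m(1,2)] by (simp add: card_image Suc_le_eq image_iff)
  have "v \<in> descs c N f \<longleftrightarrow> (f (Suc v) < Suc v \<longleftrightarrow> c)"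
    using v1 fv m M by (auto simp: descs_iff)
  moreover have "\<not> Suc v \<le> f N"
  proof
    assume "Suc v \<le> f N"
    then have "f N \<in> {v<..N}" using involutionD(6)[OF f, of N] v1 by auto
    then have "f (f N) < f v" using M by blast
    then show False using involutionD(1)[OF f, of N] fv by simp
  qed
  ultimately show "card (descs c (Suc (Suc N)) (ins_pair N (Suc v) f)) = card (descs c N f)"
    using card_descs_ins_pair[OF f m(1,2), of c] m(3) by simp
qed

lemma site_top:
  assumes f: "involution N f"
  shows "card (lr_maxima (Suc (Suc N)) (ins_pair N (Suc N) f)) = Suc (card (lr_maxima N f))"
    "card (ra_maxima (Suc (Suc N)) (ins_pair N (Suc N) f)) = 1"
    "card (descs False (Suc (Suc N)) (ins_pair N (Suc N) f)) = card (descs False N f)"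
    "card (descs True (Suc (Suc N)) (ins_pair N (Suc N) f)) = Suc (card (descs True N f))"
proof -
  have m: "1 \<le> Suc N" "Suc N \<le> Suc N" by auto
  have "{i \<in> lr_maxima N f. i < Suc N} = lr_maxima N f" "Suc N \<notin> lr_maxima N f"
    using maxima_subset(1)[of N f] by auto
  then show "card (lr_maxima (Suc (Suc N)) (ins_pair N (Suc N) f)) = Suc (card (lr_maxima N f))"
    using lr_maxima_ins_pair[OF f m] by simp
  have "{v \<in> ra_maxima N f. Suc N \<le> v} = {}" using maxima_subset(3)[of N f] by auto
  then show "card (ra_maxima (Suc (Suc N)) (ins_pair N (Suc N) f)) = 1"
    unfolding ra_maxima_ins_pair[OF f m] by (simp only: image_empty card.insert_remove finite.emptyI) simp
  have "N \<notin> descs c N f" for c by (simp add: descs_iff)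
  then show "card (descs False (Suc (Suc N)) (ins_pair N (Suc N) f)) = card (descs False N f)"
    "card (descs True (Suc (Suc N)) (ins_pair N (Suc N) f)) = Suc (card (descs True N f))"
    using card_descs_ins_pair[OF f m, of False] card_descs_ins_pair[OF f m, of True] by simp_all
qed

lemma append_fixed_point:
  assumes f: "involution N f"
  shows "card (lr_maxima (Suc N) f) = Suc (card (lr_maxima N f))"
    "card (ra_maxima (Suc N) f) = 0"
    "descs c (Suc N) f = descs c N f"
    "card (fixed_points (Suc N) f) = Suc (card (fixed_points N f))"
proof -
  have fN: "f (Suc N) = Suc N" using involutionD(5)[OF f] by simp
  have rng: "1 \<le> f x \<and> f x \<le> N" if "1 \<le> x" "x \<le> N" for x using involutionD(6)[OF f that] .
  have "lr_maxima (Suc N) f = insert (Suc N) (lr_maxima N f)"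
    using fN rng by (auto simp: lr_maxima_def less_Suc_eq_le le_Suc_eq)
  moreover have "Suc N \<notin> lr_maxima N f" using maxima_subset(1)[of N f] by auto
  ultimately show "card (lr_maxima (Suc N) f) = Suc (card (lr_maxima N f))" by simp
  have "i \<notin> ra_maxima (Suc N) f" for i
  proof
    assume "i \<in> ra_maxima (Suc N) f"
    then have i: "1 \<le> i" "i \<le> Suc N" "i < f i" "\<forall>j\<in>{i<..Suc N}. f j < f i"
      by (auto simp: ra_maxima_def rl_maxima_def)
    then have "i \<le> N" using fN by (cases "i = Suc N") auto
    then have "f (Suc N) < f i" using i(4) by auto
    then show False using rng[of i] i \<open>i \<le> N\<close> fN by auto
  qed
  then show "card (ra_maxima (Suc N) f) = 0" by (metis card.empty equals0I)
  show "descs c (Suc N) f = descs c N f"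
    using rng[of N] fN by (auto simp: descs_iff less_Suc_eq)
  have "fixed_points (Suc N) f = insert (Suc N) (fixed_points N f)"
    using fN by (auto simp: fixed_points_def)
  moreover have "Suc N \<notin> fixed_points N f" "finite (fixed_points N f)"
    by (auto simp: fixed_points_def)
  ultimately show "card (fixed_points (Suc N) f) = Suc (card (fixed_points N f))" by simp
qed

text \<open>The rank within \<open>A\<close> runs through \<open>1..card A\<close> exactly once.
  This replaces sites by labels, so that only the numbers of maxima matter from here on.\<close>

lemma sum_rank_le:
  fixes A :: "nat set"
  assumes "finite A"
  shows "(\<Sum>m\<in>A. h (card {i \<in> A. i \<le> m})) = (\<Sum>s=1..card A. h s)"
proof (rule sum.reindex_bij_betw)
  let ?r = "\<lambda>m. card {i \<in> A. i \<le> m}"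
  have less: "?r m < ?r m'" if "m \<in> A" "m' \<in> A" "m < m'" for m m'
  proof (rule psubset_card_mono)
    have "m' \<in> {i \<in> A. i \<le> m'} - {i \<in> A. i \<le> m}" using that by simp
    moreover have "{i \<in> A. i \<le> m} \<subseteq> {i \<in> A. i \<le> m'}" using that by auto
    ultimately show "{i \<in> A. i \<le> m} \<subset> {i \<in> A. i \<le> m'}" by blast
  qed (simp add: assms)
  have inj: "inj_on ?r A"
  proof (rule linorder_inj_onI')
    fix m m' assume "m \<in> A" "m' \<in> A" "m < m'"
    from less[OF this] show "?r m \<noteq> ?r m'" by simp
  qed
  have "?r ` A \<subseteq> {1..card A}"
  proof
    fix s assume "s \<in> ?r ` A"
    then obtain m where m: "m \<in> A" "s = ?r m" by blast
    then have "m \<in> {i \<in> A. i \<le> m}" by simp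
    then have "0 < ?r m" using assms by (subst card_gt_0_iff) auto
    moreover have "?r m \<le> card A" using assms by (intro card_mono) auto
    ultimately show "s \<in> {1..card A}" using m by simp
  qed
  then have "?r ` A = {1..card A}"
    by (rule card_subset_eq[rotated]) (simp_all add: card_image[OF inj])
  then show "bij_betw ?r A {1..card A}" using inj by (simp add: bij_betw_def)
qed

lemma sum_rank_greater:
  fixes A :: "nat set"
  assumes "finite A"
  shows "(\<Sum>v\<in>A. h (Suc (card {u \<in> A. v < u}))) = (\<Sum>t=1..card A. h t)"
proof (rule sum.reindex_bij_betw)
  let ?r = "\<lambda>v. Suc (card {u \<in> A. v < u})"
  have less: "?r m' < ?r m" if "m \<in> A" "m' \<in> A" "m < m'" for m m'
  proof (intro Suc_mono psubset_card_mono)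
    have "m' \<in> {u \<in> A. m < u} - {u \<in> A. m' < u}" using that by simp
    moreover have "{u \<in> A. m' < u} \<subseteq> {u \<in> A. m < u}" using that by auto
    ultimately show "{u \<in> A. m' < u} \<subset> {u \<in> A. m < u}" by blast
  qed (simp add: assms)
  have inj: "inj_on ?r A"
  proof (rule linorder_inj_onI')
    fix m m' assume "m \<in> A" "m' \<in> A" "m < m'"
    from less[OF this] show "?r m \<noteq> ?r m'" by simp
  qed
  have "?r ` A \<subseteq> {1..card A}"
  proof
    fix t assume "t \<in> ?r ` A"
    then obtain v where v: "v \<in> A" "t = ?r v" by blast
    then have "{u \<in> A. v < u} \<subset> A" by auto
    then have "card {u \<in> A. v < u} < card A" using assms by (intro psubset_card_mono)
    then show "t \<in> {1..card A}" using v by simp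
  qed
  then have "?r ` A = {1..card A}"
    by (rule card_subset_eq[rotated]) (simp_all add: card_image[OF inj])
  then show "bij_betw ?r A {1..card A}" using inj by (simp add: bij_betw_def)
qed

lemma sum_sites:
  assumes f: "involution N f"
  shows "(\<Sum>m\<in>sites N f. h m) = (\<Sum>m\<in>lr_maxima N f. h m) + (\<Sum>v\<in>ra_maxima N f. h (Suc v)) + (h (Suc N) :: nat)"
proof -
  have 1: "lr_maxima N f \<inter> Suc ` ra_maxima N f = {}"
  proof -
    have False if "v \<in> ra_maxima N f" "Suc v \<in> lr_maxima N f" for v
    proof -
      have "f (Suc v) < f v" using that by (auto simp: ra_maxima_def rl_maxima_def lr_maxima_def)
      moreover have "f v < f (Suc v)" using that by (auto simp: ra_maxima_def rl_maxima_def lr_maxima_def)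
      ultimately show False by simp
    qed
    then show ?thesis by auto
  qed
  \<comment> \<open>Position \<open>N\<close> is never strictly above the diagonal, so the three
    kinds of sites do not overlap.\<close>
  have "Suc N \<notin> Suc ` ra_maxima N f"
    using involutionD(6)[OF f, of N] by (auto simp: ra_maxima_def rl_maxima_def)
  moreover have "Suc N \<notin> lr_maxima N f" using maxima_subset(1)[of N f] by auto
  ultimately have 2: "(lr_maxima N f \<union> Suc ` ra_maxima N f) \<inter> {Suc N} = {}" by auto
  show ?thesis
    unfolding sites_def
    by (subst sum.union_disjoint[OF _ _ 2], simp_all, subst sum.union_disjoint[OF _ _ 1])
      (simp_all add: sum.reindex)
qed

lemma sites_bounds: "m \<in> sites N f \<Longrightarrow> 1 \<le> m \<and> m \<le> Suc N"
  using maxima_subset(1)[of N f] maxima_subset(3)[of N f] by (auto simp: sites_def)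

lemma sites_finite [simp]: "finite (sites N f)"
  by (simp add: sites_def)

text \<open>
  Level \<open>j\<close> of the generating tree.  The size is part of an element, as appending a fixed point does
  not change the function.
\<close>

definition ibp :: "nat \<Rightarrow> (nat \<times> (nat \<Rightarrow> nat)) set" where
  "ibp j = {(N, f). baxter N f \<and> involution N f \<and> N + card (fixed_points N f) = 2 * j}"

lemma ibp_finite [simp]: "finite (ibp j)"
proof (rule finite_subset)
  show "ibp j \<subseteq> (SIGMA N:{..2 * j}. {f. f permutes {1..N}})"
    by (auto simp: ibp_def baxter_def)
  show "finite (SIGMA N:{..2 * j}. {f. f permutes {1..N}})"
    by (auto intro!: finite_permutations)
qed

lemma ibp_0: "ibp 0 = {(0, id)}"
  by (auto simp: ibp_def baxter_def involution_def fixed_points_def)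

text \<open>A fixed point raises both the size and the number of fixed points by 1, a mirrored pair
  raises the size by 2. Every move therefore adds 2 to their sum, and size \<open>2 * n + p\<close>
  with \<open>p\<close> fixed points is reached after \<open>n + p\<close> moves.\<close>

lemma ibp_Suc:
  "ibp (Suc j) = (\<lambda>(N, f). (Suc N, f)) ` ibp j \<union>
    (\<lambda>((N, f), m). (Suc (Suc N), ins_pair N m f)) ` (SIGMA x:ibp j. case x of (N, f) \<Rightarrow> sites N f)"
  (is "_ = ?A \<union> ?B")
proof (intro equalityI subsetI)
  fix x assume "x \<in> ibp (Suc j)"
  then obtain N g where x: "x = (N, g)" and b: "baxter N g" and g: "involution N g"
    and c: "N + card (fixed_points N g) = 2 * Suc j"
    by (auto simp: ibp_def)
  have "N \<noteq> 0"
  proof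
    assume "N = 0"
    moreover have "fixed_points 0 g = {}" by (auto simp: fixed_points_def)
    ultimately show False using c by simp
  qed
  then obtain M where M: "N = Suc M" by (cases N) auto
  show "x \<in> ?A \<union> ?B"
  proof (cases "g N = N")
    case True
    then have i: "involution M g" using involution_last_fixed g M by simp
    then have "(M, g) \<in> ibp j"
      using b c M baxter_Suc_fixed append_fixed_point(4) by (simp add: ibp_def)
    then show ?thesis using x M by (intro UnI1 image_eqI[of _ _ "(M, g)"]) auto
  next
    case False
    then obtain K m f where k: "N = Suc (Suc K)" "1 \<le> m" "m \<le> Suc K" "involution K f"
        "g = ins_pair K m f"
      using ex_ins_pair[OF g] by metis
    then have "baxter K f" "m \<in> sites K f" using ins_pair_baxter_iff b by auto
    moreover have "K + card (fixed_points K f) = 2 * j"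
      using c k fixed_points_ins_pair by simp
    ultimately have "((K, f), m) \<in> (SIGMA x:ibp j. case x of (N, f) \<Rightarrow> sites N f)"
      using k by (simp add: ibp_def)
    then show ?thesis using x k by (intro UnI2 image_eqI) auto
  qed
next
  fix x assume "x \<in> ?A \<union> ?B"
  then show "x \<in> ibp (Suc j)"
  proof
    assume "x \<in> ?A"
    then obtain N f where x: "x = (Suc N, f)" and f: "baxter N f" "involution N f"
        "N + card (fixed_points N f) = 2 * j"
      by (auto simp: ibp_def)
    moreover have "involution (Suc N) f" using f(2) by (auto simp: involution_def)
    ultimately show ?thesis
      using baxter_Suc_fixed append_fixed_point(4) by (simp add: ibp_def)
  next
    assume "x \<in> ?B"
    then obtain N f m where x: "x = (Suc (Suc N), ins_pair N m f)"
      and f: "baxter N f" "involution N f" "N + card (fixed_points N f) = 2 * j"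
      and m: "m \<in> sites N f"
      by (auto simp: ibp_def)
    then show ?thesis
      using sites_bounds[OF m] ins_pair_baxter_iff ins_pair_involution fixed_points_ins_pair
      by (simp add: ibp_def)
  qed
qed

text \<open>No node arises twice: whether the last point is fixed tells the two kinds of move apart,
  and the image of the last point recovers \<open>m\<close>.\<close>

lemma sum_ibp_Suc:
  "(\<Sum>(N, f)\<in>ibp (Suc j). \<Phi> N f) =
    (\<Sum>(N, f)\<in>ibp j. \<Phi> (Suc N) f + (\<Sum>m\<in>sites N f. \<Phi> (Suc (Suc N)) (ins_pair N m f)) :: nat)"
proof -
  let ?A = "\<lambda>(N :: nat, f :: nat \<Rightarrow> nat). (Suc N, f)"
  let ?B = "\<lambda>((N, f), m). (Suc (Suc N), ins_pair N m f)"
  let ?S = "SIGMA x:ibp j. case x of (N, f) \<Rightarrow> sites N f"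
  have fin: "finite ?S" by (rule finite_SigmaI) auto
  have 1: "inj_on ?A (ibp j)" by (auto intro: inj_onI)
  have 2: "inj_on ?B ?S"
  proof (rule inj_onI, clarsimp)
    fix N f m f' m'
    assume "(N, f) \<in> ibp j" "m \<in> sites N f" "(N, f') \<in> ibp j" "m' \<in> sites N f'"
      "ins_pair N m f = ins_pair N m' f'"
    then show "f = f' \<and> m = m'"
      using ins_pair_inj[of N f f' m m'] sites_bounds by (auto simp: ibp_def)
  qed
  have 3: "?A ` ibp j \<inter> ?B ` ?S = {}"
  proof -
    have False if "(Suc N, f) = (Suc (Suc K), ins_pair K m f')" "involution N f" "m \<in> sites K f'"
      for N f K m f'
      using that involutionD(5)[of N f "Suc N"] ins_pair_simps(3)[of m K f'] sites_bounds[of m K f'] by auto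
    then show ?thesis by (auto simp: ibp_def)
  qed
  have "(\<Sum>(N, f)\<in>ibp (Suc j). \<Phi> N f) =
      (\<Sum>x\<in>ibp j. case ?A x of (N, f) \<Rightarrow> \<Phi> N f) + (\<Sum>y\<in>?S. case ?B y of (N, f) \<Rightarrow> \<Phi> N f)"
    unfolding ibp_Suc using fin 1 2 3
    by (simp add: sum.union_disjoint sum.reindex comp_def)
  also have "(\<Sum>x\<in>ibp j. case ?A x of (N, f) \<Rightarrow> \<Phi> N f) = (\<Sum>(N, f)\<in>ibp j. \<Phi> (Suc N) f)"
    by (intro sum.cong) auto
  also have "(\<Sum>y\<in>?S. case ?B y of (N, f) \<Rightarrow> \<Phi> N f) =
      (\<Sum>(x, m)\<in>?S. case x of (N, f) \<Rightarrow> \<Phi> (Suc (Suc N)) (ins_pair N m f))"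
    by (intro sum.cong) auto
  also have "\<dots> = (\<Sum>x\<in>ibp j. \<Sum>m\<in>(case x of (N, f) \<Rightarrow> sites N f).
      case x of (N, f) \<Rightarrow> \<Phi> (Suc (Suc N)) (ins_pair N m f))"
    by (intro sum.Sigma[symmetric]) auto
  also have "\<dots> = (\<Sum>(N, f)\<in>ibp j. \<Sum>m\<in>sites N f. \<Phi> (Suc (Suc N)) (ins_pair N m f))"
    by (intro sum.cong) auto
  finally show ?thesis by (simp add: sum.distrib[symmetric] case_prod_unfold)
qed

section \<open>Counting the branches below a node by its labels and statistics\<close>

definition weight :: "nat \<Rightarrow> nat \<Rightarrow> nat \<Rightarrow> nat \<Rightarrow> nat \<Rightarrow> nat \<Rightarrow> nat \<Rightarrow> nat \<Rightarrow> nat \<Rightarrow> nat" where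
  "weight k p r m a b d q c = (\<Sum>w | length w = m. drops w a * runs k p r w b d q c)"

lemma weight_0: "weight k p r 0 a b d q c = (if d = 2 * k \<and> q = p \<and> c = r then 1 else 0)"
  by (simp add: weight_def)

text \<open>This is the branching rule of the tree. On \<open>True\<close> only \<open>drops\<close>
  branches, on \<open>False\<close> only \<open>runs\<close>; each letter thus puts a sum into a
  single factor, and exchanging sums gives the recursion.\<close>

lemma weight_Suc:
  "weight k p r (Suc m) a b d q c =
     (\<Sum>s=1..a. weight k p r m s (Suc b) (d + 2) q c) + (\<Sum>t=1..b. weight k p r m (Suc a) t d q c)
     + weight k p r m (Suc a) 0 d (Suc q) c + weight k p r m (Suc a) 1 d q (Suc c)"
proof -
  have 1: "(\<Sum>w | length w = m. drops (True # w) a * runs k p r (True # w) b d q c) =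
      (\<Sum>s=1..a. weight k p r m s (Suc b) (d + 2) q c)"
    unfolding weight_def drops.simps runs.simps sum_distrib_right by (rule sum.swap)
  have 2: "(\<Sum>w | length w = m. drops (False # w) a * (\<Sum>t=1..b. runs k p r w t d q c)) =
      (\<Sum>t=1..b. weight k p r m (Suc a) t d q c)"
    unfolding weight_def drops.simps sum_distrib_left by (rule sum.swap)
  show ?thesis
    using 1 2 unfolding weight_def[of _ _ _ "Suc m"] sum_words_Suc
    by (simp add: distrib_left sum.distrib weight_def)
qed

definition ibp_weight :: "nat \<Rightarrow> nat \<Rightarrow> nat \<Rightarrow> nat \<Rightarrow> nat \<Rightarrow> (nat \<Rightarrow> nat) \<Rightarrow> nat" where
  "ibp_weight k p r m N f = weight k p r m (card (lr_maxima N f)) (card (ra_maxima N f))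
     (card (descs False N f)) (card (fixed_points N f)) (card (descs True N f))"

lemma ibp_weight_Suc:
  assumes f: "involution N f"
  shows "ibp_weight k p r (Suc m) N f = ibp_weight k p r m (Suc N) f
     + (\<Sum>s\<in>sites N f. ibp_weight k p r m (Suc (Suc N)) (ins_pair N s f))"
proof -
  let ?a = "card (lr_maxima N f)" and ?b = "card (ra_maxima N f)" and ?d = "card (descs False N f)"
    and ?q = "card (fixed_points N f)" and ?c = "card (descs True N f)"
  have fixp: "card (fixed_points (Suc (Suc N)) (ins_pair N s f)) = ?q" if "s \<in> sites N f" for s
    using fixed_points_ins_pair[OF f] sites_bounds[OF that] by simp
  have "(\<Sum>s\<in>lr_maxima N f. ibp_weight k p r m (Suc (Suc N)) (ins_pair N s f)) =
      (\<Sum>s\<in>lr_maxima N f. weight k p r m (card {i \<in> lr_maxima N f. i \<le> s}) (Suc ?b) (?d + 2) ?q ?c)"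
    by (intro sum.cong refl)
      (simp only: ibp_weight_def site_lr_maximum[OF f] fixp sites_def Un_iff simp_thms)
  also have "\<dots> = (\<Sum>s=1..?a. weight k p r m s (Suc ?b) (?d + 2) ?q ?c)"
    by (rule sum_rank_le) simp
  finally have L: "(\<Sum>s\<in>lr_maxima N f. ibp_weight k p r m (Suc (Suc N)) (ins_pair N s f)) = \<dots>" .
  have "(\<Sum>v\<in>ra_maxima N f. ibp_weight k p r m (Suc (Suc N)) (ins_pair N (Suc v) f)) =
      (\<Sum>v\<in>ra_maxima N f. weight k p r m (Suc ?a) (Suc (card {u \<in> ra_maxima N f. v < u})) ?d ?q ?c)"
    by (intro sum.cong refl)
      (simp only: ibp_weight_def site_ra_maximum[OF f] fixp sites_def Un_iff imageI simp_thms)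
  also have "\<dots> = (\<Sum>t=1..?b. weight k p r m (Suc ?a) t ?d ?q ?c)"
    by (rule sum_rank_greater) simp
  finally have R: "(\<Sum>v\<in>ra_maxima N f. ibp_weight k p r m (Suc (Suc N)) (ins_pair N (Suc v) f)) = \<dots>" .
  have T: "ibp_weight k p r m (Suc (Suc N)) (ins_pair N (Suc N) f) =
      weight k p r m (Suc ?a) 1 ?d ?q (Suc ?c)"
    by (simp only: ibp_weight_def site_top[OF f] fixp sites_def Un_iff insertI1 simp_thms)
  have F: "ibp_weight k p r m (Suc N) f = weight k p r m (Suc ?a) 0 ?d (Suc ?q) ?c"
    by (simp only: ibp_weight_def append_fixed_point[OF f])
  show ?thesis
    unfolding sum_sites[OF f] L R T F unfolding ibp_weight_def weight_Suc by simp
qed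

text \<open>Descending one level while shortening the remaining branches by one leaves the sum
  unchanged, so it can be evaluated at the root, whose labels and statistics are all 0. With
  \<open>m = 0\<close> it counts the nodes of a level with the prescribed statistics.\<close>

lemma sum_ibp_weight:
  "(\<Sum>(N, f)\<in>ibp j. ibp_weight k p r m N f) = weight k p r (j + m) 0 0 0 0 0"
proof (induction j arbitrary: m)
  case 0
  have "lr_maxima 0 id = {}" "ra_maxima 0 id = {}" "descs c 0 id = {}" "fixed_points 0 id = {}" for c
    by (auto simp: lr_maxima_def ra_maxima_def rl_maxima_def descs_iff fixed_points_def)
  then show ?case by (simp add: ibp_0 ibp_weight_def)
next
  case (Suc j)
  have "(\<Sum>(N, f)\<in>ibp (Suc j). ibp_weight k p r m N f) = (\<Sum>(N, f)\<in>ibp j. ibp_weight k p r (Suc m) N f)"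
    unfolding sum_ibp_Suc by (intro sum.cong) (auto simp: ibp_def ibp_weight_Suc)
  then show ?case using Suc[of "Suc m"] by simp
qed

lemma card_involutive_baxter_permutations:
  "card (involutive_baxter_permutations n k p r) =
     (\<Sum>w | length w = n + p. if count_list w True = k
      then drops w 0 * ((p + r choose r) * gaps w r (p + r)) else 0)"
proof -
  let ?P = "\<lambda>(N, f). card (descs False N f) = 2 * k \<and> card (fixed_points N f) = p \<and> card (descs True N f) = r"
  have nf: "card (non_fixed_points N f) = N - card (fixed_points N f)" for N f
  proof -
    have "non_fixed_points N f = {1..N} - fixed_points N f"
      by (auto simp: non_fixed_points_def fixed_points_def)
    moreover have "fixed_points N f \<subseteq> {1..N}" by (auto simp: fixed_points_def)
    ultimately show ?thesis by (simp add: card_Diff_subset finite_subset)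
  qed
  have d: "descs False N f = {i \<in> descents N f. \<not> crosses_diagonal f i}"
    "descs True N f = {i \<in> descents N f. crosses_diagonal f i}" for N f
    by (auto simp: descs_def)
  have inv: "baxter N f \<and> involutive f \<longleftrightarrow> baxter N f \<and> involution N f" for N f
    by (auto simp: involution_iff baxter_def)
  have inj: "inj_on (\<lambda>f :: nat \<Rightarrow> nat. (2 * n + p, f)) X" for X by (auto intro: inj_onI)
  have "(\<lambda>f. (2 * n + p, f)) ` involutive_baxter_permutations n k p r = {x \<in> ibp (n + p). ?P x}"
  proof (intro equalityI subsetI)
    fix x assume "x \<in> (\<lambda>f. (2 * n + p, f)) ` involutive_baxter_permutations n k p r"
    then show "x \<in> {x \<in> ibp (n + p). ?P x}"
      using inv by (auto simp: involutive_baxter_permutations_def ibp_def d)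
  next
    fix x assume "x \<in> {x \<in> ibp (n + p). ?P x}"
    then obtain N f where x: "x = (N, f)" "baxter N f" "involution N f"
        "N + card (fixed_points N f) = 2 * (n + p)" "?P (N, f)"
      by (auto simp: ibp_def)
    then have "N = 2 * n + p" by simp
    with x have "f \<in> involutive_baxter_permutations n k p r"
      using inv nf[of N f] by (auto simp: involutive_baxter_permutations_def d)
    then show "x \<in> (\<lambda>f. (2 * n + p, f)) ` involutive_baxter_permutations n k p r"
      using x \<open>N = 2 * n + p\<close> by auto
  qed
  then have "card (involutive_baxter_permutations n k p r) = card {x \<in> ibp (n + p). ?P x}"
    using card_image[OF inj, of "involutive_baxter_permutations n k p r"] by simp
  also have "\<dots> = (\<Sum>x\<in>ibp (n + p). if ?P x then 1 else 0)"
    by (simp only: card_eq_sum sum.inter_filter ibp_finite)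
  also have "\<dots> = (\<Sum>(N, f)\<in>ibp (n + p). ibp_weight k p r 0 N f)"
    by (intro sum.cong refl) (simp add: ibp_weight_def weight_0 split_beta)
  also have "\<dots> = weight k p r (n + p) 0 0 0 0 0"
    using sum_ibp_weight[of k p r 0 "n + p"] by simp
  also have "\<dots> = (\<Sum>w | length w = n + p. if count_list w True = k
      then drops w 0 * ((p + r choose r) * gaps w r (p + r)) else 0)"
    unfolding weight_def by (intro sum.cong) (auto simp: runs_eq_fills fills_eq)
  finally show ?thesis .
qed

section \<open>Non-intersecting triples of walks\<close>

definition walks_avoiding :: "point \<Rightarrow> point \<Rightarrow> point set \<Rightarrow> point list set" where
  "walks_avoiding a b U = {w. binary_walk a b w \<and> set w \<inter> U = {}}"

lemma binary_walk_snoc_iff: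
  "binary_walk a b w \<longleftrightarrow> w = [a] \<and> a = b \<or>
    (\<exists>w'. w = w' @ [b] \<and>
      (binary_walk a (fst b - 1, snd b) w' \<or> binary_walk a (fst b, snd b - 1) w'))"
proof (cases w rule: rev_cases)
  case (snoc v c)
  have "binary_step (last v) b \<longleftrightarrow> last v = (fst b - 1, snd b) \<or> last v = (fst b, snd b - 1)"
    by (cases "last v"; cases b) (auto simp: binary_step_def)
  then show ?thesis
    using snoc by (cases "v = []") (auto simp: binary_walk_def successively_append_iff)
qed (simp add: binary_walk_def)

lemma binary_walk_bounds:
  assumes "binary_walk a b w" "z \<in> set w"
  shows "fst a \<le> fst z \<and> snd a \<le> snd z \<and> fst z \<le> fst b \<and> snd z \<le> snd b"
  using assms
proof (induction w arbitrary: b z rule: rev_induct)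
  case (snoc c w)
  have aux: "fst a \<le> fst b' \<and> snd a \<le> snd b'" if "binary_walk a b' w" for b'
  proof -
    have "w \<noteq> []" "b' = last w" using that by (auto simp: binary_walk_def)
    then show ?thesis using snoc.IH[OF that, of b'] by simp
  qed
  from snoc.prems(1) consider "w = []" "a = b" "c = b"
    | b' where "c = b" "binary_walk a b' w" "b' = (fst b - 1, snd b) \<or> b' = (fst b, snd b - 1)"
    by (subst (asm) binary_walk_snoc_iff) auto
  then show ?case
  proof cases
    case 1
    then show ?thesis using snoc.prems(2) by auto
  next
    case 2
    then show ?thesis using snoc.prems(2) snoc.IH[OF 2(2), of z] aux[OF 2(2)] by auto
  qed
qed (simp add: binary_walk_def)

lemma binary_walk_nth_diagonal:
  assumes "binary_walk a b w" "i < length w"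
  shows "fst (w ! i) + snd (w ! i) = fst a + snd a + int i"
  using assms(2)
proof (induction i)
  case 0
  then show ?case using assms(1) by (simp add: binary_walk_def hd_conv_nth)
next
  case (Suc i)
  have "binary_step (w ! i) (w ! Suc i)"
    using assms(1) Suc.prems by (auto simp: binary_walk_def successively_conv_nth)
  then show ?case using Suc by (auto simp: binary_step_def)
qed

lemma binary_walk_length:
  assumes "binary_walk a b w"
  shows "int (length w) = fst b - fst a + (snd b - snd a) + 1"
proof -
  have "w \<noteq> []" "b = w ! (length w - 1)"
    using assms by (auto simp: binary_walk_def last_conv_nth)
  then show ?thesis using binary_walk_nth_diagonal[OF assms, of "length w - 1"] by (cases w) auto
qed

lemma finite_walks_avoiding [simp]: "finite (walks_avoiding a b U)"
proof (rule finite_subset)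
  let ?B = "{fst a..fst b} \<times> {snd a..snd b}"
  let ?n = "nat (fst b - fst a + (snd b - snd a) + 1)"
  show "walks_avoiding a b U \<subseteq> {w. set w \<subseteq> ?B \<and> length w = ?n}"
  proof
    fix w assume "w \<in> walks_avoiding a b U"
    then have w: "binary_walk a b w" by (simp add: walks_avoiding_def)
    then show "w \<in> {w. set w \<subseteq> ?B \<and> length w = ?n}"
      using binary_walk_bounds[OF w] binary_walk_length[OF w] by (auto simp: mem_Times_iff)
  qed
  show "finite {w. set w \<subseteq> ?B \<and> length w = ?n}" by (rule finite_lists_length_eq) simp
qed

lemma walks_avoiding_empty:
  "fst b < fst a \<or> snd b < snd a \<Longrightarrow> walks_avoiding a b U = {}"
  unfolding walks_avoiding_def
  using binary_walk_bounds[of a b _ b] by (auto simp: binary_walk_def) (metis last_in_set not_le)+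

lemma walks_avoiding_insert:
  assumes "fst b < fst u \<or> snd b < snd u"
  shows "walks_avoiding a b (insert u U) = walks_avoiding a b U"
  unfolding walks_avoiding_def using binary_walk_bounds[of a b _ u] assms by fastforce

lemma card_walks_avoiding:
  "card (walks_avoiding a b U) = (if b \<in> U then 0 else if a = b then 1
     else card (walks_avoiding a (fst b - 1, snd b) U) + card (walks_avoiding a (fst b, snd b - 1) U))"
proof -
  let ?E = "walks_avoiding a (fst b - 1, snd b) U" and ?N = "walks_avoiding a (fst b, snd b - 1) U"
  have in_U: "walks_avoiding a b U = {}" if "b \<in> U"
    using that by (auto simp: walks_avoiding_def binary_walk_def) (metis IntI empty_iff last_in_set)
  have split: "walks_avoiding a b U = (if a = b then {[a]} else {}) \<union> (\<lambda>w. w @ [b]) ` ?E \<union> (\<lambda>w. w @ [b]) ` ?N"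
    if "b \<notin> U"
  proof (rule set_eqI)
    fix w
    show "w \<in> walks_avoiding a b U \<longleftrightarrow>
        w \<in> (if a = b then {[a]} else {}) \<union> (\<lambda>w. w @ [b]) ` ?E \<union> (\<lambda>w. w @ [b]) ` ?N"
      unfolding walks_avoiding_def mem_Collect_eq using that
      by (subst binary_walk_snoc_iff) (auto simp: image_iff)
  qed
  have disj: "(\<lambda>w. w @ [b]) ` ?E \<inter> (\<lambda>w. w @ [b]) ` ?N = {}"
    by (auto simp: walks_avoiding_def binary_walk_def)
  have "inj_on (\<lambda>w. w @ [b]) X" for X :: "point list set" by (auto intro: inj_onI)
  then have "card ((\<lambda>w. w @ [b]) ` ?E \<union> (\<lambda>w. w @ [b]) ` ?N) = card ?E + card ?N"
    using disj by (simp add: card_Un_disjoint card_image)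
  moreover have "?E = {}" "?N = {}" if "a = b" using that by (auto intro!: walks_avoiding_empty)
  ultimately show ?thesis using in_U split by (cases "b \<in> U"; cases "a = b") simp_all
qed

section \<open>Walks as words read backwards from the end point, \<open>True\<close> undoing an East
  step\<close>

fun back_walk :: "point \<Rightarrow> bool list \<Rightarrow> point list" where
  "back_walk c [] = [c]"
| "back_walk c (x # w) = c # back_walk (if x then (fst c - 1, snd c) else (fst c, snd c - 1)) w"

lemma back_walk_neq_Nil [simp]: "back_walk c w \<noteq> []" "[] \<noteq> back_walk c w"
  by (cases w; auto)+

lemma last_back_walk:
  "last (back_walk c w) = (fst c - int (count_list w True), snd c - int (count_list w False))"
  by (induction w arbitrary: c) auto

lemma binary_walk_back_walk: "binary_walk (last (back_walk c w)) c (rev (back_walk c w))"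
proof (induction w arbitrary: c)
  case Nil
  then show ?case by (simp add: binary_walk_def)
next
  case (Cons x w)
  show ?case
    by (subst binary_walk_snoc_iff) (use Cons in \<open>cases x; auto\<close>)
qed

lemma back_walk_bounds:
  "z \<in> set (back_walk c w) \<Longrightarrow> fst z \<le> fst c \<and> snd z \<le> snd c"
  using binary_walk_bounds[OF binary_walk_back_walk, of z c w] by simp

lemma back_walk_inj: "back_walk c w = back_walk c w' \<Longrightarrow> w = w'"
proof (induction w arbitrary: c w')
  case Nil
  then show ?case by (cases w') auto
next
  case (Cons x w)
  then obtain x' v where w': "w' = x' # v" by (cases w') auto
  have hd: "hd (back_walk d u) = d" for d u by (cases u) auto
  have e: "back_walk (if x then (fst c - 1, snd c) else (fst c, snd c - 1)) w =
      back_walk (if x' then (fst c - 1, snd c) else (fst c, snd c - 1)) v"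
    using Cons.prems w' by simp
  have "(if x then (fst c - 1, snd c) else (fst c, snd c - 1)) =
      (if x' then (fst c - 1, snd c) else (fst c, snd c - 1))"
    using arg_cong[OF e, of hd] by (simp only: hd)
  then have "x = x'" by (cases x; cases x') auto
  with e Cons.IH w' show ?case by simp
qed

lemma ex_back_walk: "binary_walk a c v \<Longrightarrow> \<exists>w. v = rev (back_walk c w)"
proof (induction v arbitrary: c rule: rev_induct)
  case (snoc d v)
  from snoc.prems consider "v = []" "a = c" "d = c"
    | x where "d = c" "binary_walk a (if x then (fst c - 1, snd c) else (fst c, snd c - 1)) v"
    by (subst (asm) binary_walk_snoc_iff) (auto; metis (full_types))
  then show ?case
  proof cases
    case 1
    then show ?thesis by (intro exI[of _ "[]"]) simp
  next
    case 2
    then obtain w where "v = rev (back_walk (if x then (fst c - 1, snd c) else (fst c, snd c - 1)) w)"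
      using snoc.IH by blast
    then show ?thesis using 2 by (intro exI[of _ "x # w"]) simp
  qed
qed (simp add: binary_walk_def)

text \<open>Stepping back along a North step of \<open>W2\<close> increases the height of the end of
  \<open>W1\<close> above it. Stepping back along an East step puts \<open>W2\<close> into the last
  column of \<open>W1\<close>, which \<open>W1\<close> then enters from the left at some height
  \<open>s\<close> from 1 to \<open>a\<close> above it; this is the sum in \<open>drops\<close>. For
  the empty word and \<open>a = 0\<close> the end of \<open>W1\<close> would lie below its
  start.\<close>

lemma card_walks_above:
  assumes "w \<noteq> [] \<or> 0 < a"
  shows "card (walks_avoiding (fst (last (back_walk c w)) - 1, snd (last (back_walk c w)) + 1)
    (fst c - 1, snd c + int a) (set (back_walk c w))) = drops w a"
  using assms
proof (induction w a arbitrary: c rule: drops.induct)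
  case (1 a)
  have "card (walks_avoiding (fst c - 1, snd c + 1) (fst c - 1, snd c + 1 + int a) {c}) = 1" for a
  proof (induction a)
    case 0
    show ?case by (subst card_walks_avoiding) (auto simp: prod_eq_iff)
  next
    case (Suc a)
    then show ?case
      by (subst card_walks_avoiding) (auto simp: prod_eq_iff walks_avoiding_empty algebra_simps)
  qed
  from this[of "a - 1"] show ?case using 1 by (simp add: of_nat_diff)
next
  case (2 w a)
  let ?c = "(fst c - 1, snd c)" and ?o = "last (back_walk c (True # w))"
  let ?W = "\<lambda>a. walks_avoiding (fst ?o - 1, snd ?o + 1) (fst c - 1, snd c + int a) (set (back_walk ?c w))"
  have o: "?o = last (back_walk ?c w)" by simp
  have "card (?W a') = (\<Sum>s=1..a'. drops w s)" if "a' \<le> a" for a'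
    using that
  proof (induction a')
    case 0
    have "?c \<in> set (back_walk ?c w)" by (cases w) auto
    then show ?case by (subst card_walks_avoiding) simp
  next
    case (Suc a')
    have "card (walks_avoiding (fst ?o - 1, snd ?o + 1) (fst c - 1 - 1, snd c + int (Suc a')) (set (back_walk ?c w)))
        = drops w (Suc a')"
      using 2(1)[of "Suc a'" ?c] Suc.prems o by simp
    moreover have ni: "(fst c - 1, snd c + int (Suc a')) \<notin> set (back_walk ?c w)"
      using back_walk_bounds[of _ ?c w] by fastforce
    moreover have ne: "(fst ?o - 1, snd ?o + 1) \<noteq> (fst c - 1, snd c + int (Suc a'))"
      using back_walk_bounds[of "last (back_walk ?c w)" ?c w] by simp
    have "snd c + int (Suc a') - 1 = snd c + int a'" by simp
    then have "card (?W (Suc a')) = card (walks_avoiding (fst ?o - 1, snd ?o + 1)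
        (fst c - 1 - 1, snd c + int (Suc a')) (set (back_walk ?c w))) + card (?W a')"
      by (subst card_walks_avoiding) (simp only: ni ne if_False fst_conv snd_conv)
    ultimately show ?case using Suc by simp
  qed
  \<comment> \<open>The point \<open>c\<close> lies one column beyond the end of \<open>W1\<close>
    and is no obstacle.\<close>
  then show ?case by (simp add: walks_avoiding_insert)
next
  case (3 w a)
  then show ?case
    using 3(1)[of "(fst c, snd c - 1)"] by (simp add: walks_avoiding_insert algebra_simps)
qed

text \<open>While \<open>q > 0\<close>, undoing a North step of \<open>W2\<close> only reduces the
  number of rows between the end points. At \<open>q = 0\<close> it puts \<open>W2\<close> into the
  last row of \<open>W3\<close>, which \<open>W3\<close> then enters from below at some column
  \<open>t\<close> from 1 to \<open>g\<close> to the right.\<close>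

lemma card_walks_below:
  "card (walks_avoiding (fst (last (back_walk c w)), snd (last (back_walk c w)) - 1)
    (fst c + int g, snd c - 1 - int q) (set (back_walk c w))) = gaps w g q"
proof (induction w g q arbitrary: c rule: gaps.induct)
  case (1 g q)
  show ?case
  proof (cases q)
    case 0
    have "card (walks_avoiding (fst c, snd c - 1) (fst c + int g, snd c - 1) {c}) = 1"
    proof (induction g)
      case 0
      show ?case by (subst card_walks_avoiding) (auto simp: prod_eq_iff)
    next
      case (Suc g)
      then show ?case
        by (subst card_walks_avoiding) (auto simp: prod_eq_iff walks_avoiding_empty algebra_simps)
    qed
    then show ?thesis using 0 by simp
  next
    case (Suc q')
    then show ?thesis by (simp add: walks_avoiding_empty)
  qed
next
  case (2 w g q)
  then show ?case
    using 2[of "(fst c - 1, snd c)"] by (simp add: walks_avoiding_insert algebra_simps)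
next
  case (3 w g)
  let ?c = "(fst c, snd c - 1)" and ?o = "last (back_walk c (False # w))"
  let ?W = "\<lambda>g. walks_avoiding (fst ?o, snd ?o - 1) (fst c + int g, snd c - 1) (set (back_walk ?c w))"
  have o: "?o = last (back_walk ?c w)" by simp
  have "card (?W g') = (\<Sum>t=1..g'. gaps w t 0)" if "g' \<le> g" for g'
    using that
  proof (induction g')
    case 0
    have "?c \<in> set (back_walk ?c w)" by (cases w) auto
    then show ?case by (subst card_walks_avoiding) simp
  next
    case (Suc g')
    have "card (walks_avoiding (fst ?o, snd ?o - 1) (fst c + int (Suc g'), snd c - 1 - 1) (set (back_walk ?c w)))
        = gaps w (Suc g') 0"
      using 3(1)[of "Suc g'" ?c] Suc.prems o by simp
    moreover have ni: "(fst c + int (Suc g'), snd c - 1) \<notin> set (back_walk ?c w)"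
      using back_walk_bounds[of _ ?c w] by fastforce
    moreover have ne: "(fst ?o, snd ?o - 1) \<noteq> (fst c + int (Suc g'), snd c - 1)"
      using back_walk_bounds[of "last (back_walk ?c w)" ?c w] by simp
    have "fst c + int (Suc g') - 1 = fst c + int g'" by simp
    then have "card (?W (Suc g')) = card (?W g') + card (walks_avoiding (fst ?o, snd ?o - 1)
        (fst c + int (Suc g'), snd c - 1 - 1) (set (back_walk ?c w)))"
      by (subst card_walks_avoiding) (simp only: ni ne if_False fst_conv snd_conv)
    ultimately show ?case using Suc by simp
  qed
  then show ?case by (simp add: walks_avoiding_insert)
next
  case (4 w g q)
  then show ?case
    using 4[of "(fst c, snd c - 1)"] by (simp add: walks_avoiding_insert algebra_simps)
qed

text \<open>On each antidiagonal the horizontal distance changes by at most 1 per step, so it cannot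
  change sign without vanishing, which would be a common point.\<close>

lemma strictly_left:
  assumes "\<And>i. i < L \<Longrightarrow> binary_step (f i) (f (Suc i)) \<and> binary_step (g i) (g (Suc i))"
    and "\<And>i. i \<le> L \<Longrightarrow> f i \<noteq> g i"
    and "fst (f 0) + snd (f 0) = fst (g 0) + snd (g 0)" "fst (f 0) < fst (g 0)"
  shows "i \<le> L \<Longrightarrow> fst (f i) + snd (f i) = fst (g i) + snd (g i) \<and> fst (f i) < fst (g i)"
proof (induction i)
  case (Suc i)
  then show ?case
    using assms(1)[of i] assms(2)[of "Suc i"] by (auto simp: binary_step_def prod_eq_iff)
qed (use assms in simp)

text \<open>On every antidiagonal \<open>W1\<close> lies strictly to the left of \<open>W2\<close>, and \<open>W2\<close> of \<open>W3\<close>.\<close>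

lemma outer_walks_disjoint:
  assumes w1: "binary_walk (-1, 1) (x - 1, y + 1) w1" and w2: "binary_walk (0, 0) (x, y) w2"
    and w3: "binary_walk (0, -1) e w3" and e: "fst e + snd e \<le> x + y"
    and disj: "set w1 \<inter> set w2 = {}" "set w3 \<inter> set w2 = {}"
  shows "set w1 \<inter> set w3 = {}"
proof (rule ccontr)
  assume "set w1 \<inter> set w3 \<noteq> {}"
  then obtain z where "z \<in> set w1" "z \<in> set w3" by blast
  then obtain i j where i: "i < length w1" and j: "j < length w3" and ij: "w1 ! i = w3 ! j"
    by (metis in_set_conv_nth)
  have len: "length w1 = length w2" "length w3 \<le> Suc (length w2)"
    using binary_walk_length[OF w1] binary_walk_length[OF w2] binary_walk_length[OF w3] e by auto
  have step: "binary_step (w ! l) (w ! Suc l)" if "binary_walk a b w" "Suc l < length w" for a b w l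
    using that by (auto simp: binary_walk_def successively_conv_nth)
  have hd: "w1 ! 0 = (-1, 1)" "w2 ! 0 = (0, 0)" "w3 ! 0 = (0, -1)"
    using w1 w2 w3 by (auto simp: binary_walk_def hd_conv_nth)
  \<comment> \<open>\<open>W3\<close> starts one antidiagonal below \<open>W1\<close> and
    \<open>W2\<close>; comparing it with them means shifting its index by one.\<close>
  have jS: "j = Suc i"
    using binary_walk_nth_diagonal[OF w1 i] binary_walk_nth_diagonal[OF w3 j] ij by simp
  have "fst (w1 ! i) < fst (w2 ! i)"
  proof (rule strictly_left[where L = i and f = "(!) w1" and g = "(!) w2" and i = i, THEN conjunct2])
    show "w1 ! l \<noteq> w2 ! l" if "l \<le> i" for l
      using that i len disj(1) by (metis disjoint_iff le_less_trans nth_mem)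
  qed (use i len step[OF w1] step[OF w2] hd in auto)
  moreover have "fst (w2 ! i) < fst (w3 ! Suc i)"
  proof (rule strictly_left[where L = i and f = "(!) w2" and g = "\<lambda>l. w3 ! Suc l" and i = i, THEN conjunct2])
    have ne: "w2 ! l \<noteq> w3 ! Suc l" if "l \<le> i" for l
    proof -
      have "w2 ! l \<in> set w2" "w3 ! Suc l \<in> set w3" using that i j jS len by auto
      then show ?thesis using disj(2) by auto
    qed
    show "w2 ! l \<noteq> w3 ! Suc l" if "l \<le> i" for l using ne[OF that] .
    \<comment> \<open>A first step North would lead to the start of \<open>W2\<close>, so
      \<open>W3\<close> begins with a step East.\<close>
    have "binary_step (w3 ! 0) (w3 ! Suc 0)" using step[OF w3] j jS by simp
    then have "w3 ! Suc 0 = (1, -1) \<or> w3 ! Suc 0 = (0, 0)" by (auto simp: binary_step_def hd)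
    then have "w3 ! Suc 0 = (1, -1)" using ne[of 0] hd by auto
    then show "fst (w2 ! 0) + snd (w2 ! 0) = fst (w3 ! Suc 0) + snd (w3 ! Suc 0)"
      "fst (w2 ! 0) < fst (w3 ! Suc 0)" using hd by auto
  qed (use i j jS len step[OF w2] step[OF w3] in auto)
  ultimately show False using ij jS by simp
qed

text \<open>Stars and bars; the same coefficient counts the orders of \<open>p\<close> resets to 0
  and \<open>r\<close> resets to 1.\<close>

lemma card_compositions:
  "card {s :: nat list. length s = r + 1 \<and> sum_list s = p} = (p + r choose r)"
  unfolding card_length_sum_list using binomial_symmetric[of p "p + r"] by simp

lemma finite_compositions: "finite {s :: nat list. length s = r + 1 \<and> sum_list s = p}"
  by (intro card_ge_0_finite) (simp add: card_compositions[simplified])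

lemma finite_walk_tuples: "finite (walk_tuples n k p r)"
proof (rule finite_subset)
  let ?X = "walks_avoiding (-1, 1) (int k - 1, int n + int p - int k) {} \<times>
    walks_avoiding (0, 0) (int k, int n + int p - int k - 1) {} \<times>
    walks_avoiding (0, -1) (int k + int r, int n - int k - int r - 1) {} \<times>
    {s. length s = r + 1 \<and> sum_list s = p}"
  show "walk_tuples n k p r \<subseteq> ?X"
    by (auto simp: walk_tuples_def walks_avoiding_def)
  show "finite ?X"
    by (intro finite_cartesian_product finite_walks_avoiding finite_compositions)
qed

text \<open>
  The word is prefixed with a North step, leading one point beyond the end of \<open>W2\<close>: it stands for
  the first move of the generating tree, which is never of the third kind.
\<close>

lemma card_walk_tuples:
  assumes "n + p = Suc m"
  shows "card (walk_tuples n k p r) =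
    (\<Sum>w | length w = m \<and> count_list w True = k.
       drops (False # w) 0 * (gaps (False # w) r (p + r) * (p + r choose r)))"
proof -
  define c where "c = (int k, int m - int k)"
  have M: "int n + int p = int m + 1" using assms by linarith
  define A where "A U = walks_avoiding (-1, 1) (int k - 1, int n + int p - int k) U" for U
  define B where "B U = walks_avoiding (0, -1) (int k + int r, int n - int k - int r - 1) U" for U
  define P where "P = {w2. binary_walk (0, 0) c w2}"
  define S where "S = {s :: nat list. length s = r + 1 \<and> sum_list s = p}"
  have cardS: "card S = (p + r choose r)"
    unfolding S_def by (rule card_compositions)
  have finS: "finite S"
    unfolding S_def by (rule finite_compositions)
  let ?g = "\<lambda>(w2, w1, w3, s). (w1, w2, w3, s)"
  \<comment> \<open>For a fixed \<open>W2\<close> the other components are independent, disjointness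
    of \<open>W1\<close> and \<open>W3\<close> being automatic.\<close>
  have "walk_tuples n k p r = ?g ` (SIGMA w2:P. A (set w2) \<times> B (set w2) \<times> S)"
  proof (intro equalityI subsetI)
    fix t assume "t \<in> walk_tuples n k p r"
    then obtain w1 w2 w3 s where t: "t = (w1, w2, w3, s)"
      and "binary_walk (-1, 1) (int k - 1, int n + int p - int k) w1"
      and "binary_walk (0, 0) (int k, int n + int p - int k - 1) w2"
      and "binary_walk (0, -1) (int k + int r, int n - int k - int r - 1) w3"
      and "non_intersecting w1 w2 w3" "length s = r + 1 \<and> sum_list s = p"
      by (auto simp: walk_tuples_def)
    then have "(w2, w1, w3, s) \<in> (SIGMA w2:P. A (set w2) \<times> B (set w2) \<times> S)"
      using M by (auto simp: A_def B_def S_def P_def c_def walks_avoiding_def non_intersecting_def)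
    then show "t \<in> ?g ` (SIGMA w2:P. A (set w2) \<times> B (set w2) \<times> S)"
      using t by (intro image_eqI) auto
  next
    fix t assume "t \<in> ?g ` (SIGMA w2:P. A (set w2) \<times> B (set w2) \<times> S)"
    then obtain w1 w2 w3 s where t: "t = (w1, w2, w3, s)" and w2: "binary_walk (0, 0) c w2"
      and w1: "binary_walk (-1, 1) (int k - 1, int n + int p - int k) w1" "set w1 \<inter> set w2 = {}"
      and w3: "binary_walk (0, -1) (int k + int r, int n - int k - int r - 1) w3" "set w3 \<inter> set w2 = {}"
      and s: "length s = r + 1 \<and> sum_list s = p"
      by (auto simp: A_def B_def S_def P_def walks_avoiding_def)
    have c1: "(int k - 1, int n + int p - int k) = (int k - 1, (int m - int k) + 1)"
      "c = (int k, int n + int p - int k - 1)"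
      using M by (simp_all add: c_def)
    have "set w1 \<inter> set w3 = {}"
      by (rule outer_walks_disjoint[OF w1(1)[unfolded c1(1)] w2[unfolded c_def] w3(1) _ w1(2) w3(2)])
        (use M in simp)
    then have "non_intersecting w1 w2 w3"
      using w1 w3 by (auto simp: non_intersecting_def)
    then show "t \<in> walk_tuples n k p r"
      using w1 w2 w3 s t unfolding walk_tuples_def c1(2) by auto
  qed
  moreover have "inj_on ?g (SIGMA w2:P. A (set w2) \<times> B (set w2) \<times> S)" by (auto intro: inj_onI)
  ultimately have "card (walk_tuples n k p r) = card (SIGMA w2:P. A (set w2) \<times> B (set w2) \<times> S)"
    by (simp add: card_image)
  also have "\<dots> = (\<Sum>w2\<in>P. card (A (set w2) \<times> B (set w2) \<times> S))"
  proof (rule card_SigmaI)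
    have "P = walks_avoiding (0, 0) c {}" by (simp add: P_def walks_avoiding_def)
    then show "finite P" by simp
    show "\<forall>w2\<in>P. finite (A (set w2) \<times> B (set w2) \<times> S)"
      using finS by (simp add: A_def B_def)
  qed
  also have "\<dots> = (\<Sum>w | length w = m \<and> count_list w True = k.
      card (A (set (back_walk c w)) \<times> B (set (back_walk c w)) \<times> S))"
  proof (rule sum.reindex_bij_witness[where i = "\<lambda>w. rev (back_walk c w)"
        and j = "\<lambda>v. THE w. v = rev (back_walk c w)"])
    have len: "length w = count_list w True + count_list w False" for w
      by (induction w) auto
    have the: "(THE w'. rev (back_walk c w) = rev (back_walk c w')) = w" for w
      by (intro the_equality) (auto dest: back_walk_inj)
    {
      fix v assume "v \<in> P"
      then have v: "binary_walk (0, 0) c v" by (simp add: P_def)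
      then obtain w where w: "v = rev (back_walk c w)" using ex_back_walk by blast
      have "last (back_walk c w) = (0, 0)" using v w by (simp add: binary_walk_def hd_rev)
      then have "count_list w True = k" "length w = m"
        using len[of w] by (auto simp: last_back_walk c_def)
      with w the show "rev (back_walk c (THE w. v = rev (back_walk c w))) = v"
        "(THE w. v = rev (back_walk c w)) \<in> {w. length w = m \<and> count_list w True = k}"
        "card (A (set (back_walk c (THE w. v = rev (back_walk c w)))) \<times>
          B (set (back_walk c (THE w. v = rev (back_walk c w)))) \<times> S) = card (A (set v) \<times> B (set v) \<times> S)"
        by simp_all
    }
    {
      fix w assume "w \<in> {w. length w = m \<and> count_list w True = k}"
      then have "last (back_walk c w) = (0, 0)"
        using len[of w] by (auto simp: last_back_walk c_def)
      then show "rev (back_walk c w) \<in> P" using binary_walk_back_walk[of c w] by (simp add: P_def)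
      show "(THE w'. rev (back_walk c w) = rev (back_walk c w')) = w" by (rule the)
    }
  qed
  also have "\<dots> = (\<Sum>w | length w = m \<and> count_list w True = k.
       drops (False # w) 0 * (gaps (False # w) r (p + r) * (p + r choose r)))"
  proof (intro sum.cong refl)
    fix w assume w: "w \<in> {w. length w = m \<and> count_list w True = k}"
    \<comment> \<open>One step North of the end of \<open>W2\<close>. Seen from \<open>d\<close>,
      \<open>W1\<close> ends in the same row, one column to the left, hence the argument 0 of
      \<open>drops\<close>; \<open>W3\<close> ends \<open>r\<close> columns to the right and
      \<open>p + r + 1\<close> rows below. Neither can reach \<open>d\<close>, so adding it to
      \<open>W2\<close> excludes no walk.\<close>
    define d where "d = (int k, int m - int k + 1)"
    have len: "length w = count_list w True + count_list w False" for w
      by (induction w) auto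
    have bw: "back_walk d (False # w) = d # back_walk c w" by (simp add: d_def c_def)
    have l: "last (back_walk d (False # w)) = (0, 0)"
      using w len[of w] by (auto simp: last_back_walk d_def)
    have "card (A (set (back_walk c w))) = drops (False # w) 0"
      using card_walks_above[of "False # w" 0 d] unfolding l unfolding bw
      by (simp add: A_def d_def M walks_avoiding_insert algebra_simps)
    moreover have "card (B (set (back_walk c w))) = gaps (False # w) r (p + r)"
    proof -
      have e: "fst d + int r = int k + int r" "snd d - 1 - int (p + r) = int n - int k - int r - 1"
        using M by (simp_all add: d_def)
      have "int n - int k - int r - 1 < snd d" using M by (simp add: d_def)
      then show ?thesis
        using card_walks_below[of d "False # w" r "p + r"] unfolding l e unfolding bw
        by (simp add: B_def walks_avoiding_insert)
    qed
    ultimately show "card (A (set (back_walk c w)) \<times> B (set (back_walk c w)) \<times> S) =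
        drops (False # w) 0 * (gaps (False # w) r (p + r) * (p + r choose r))"
      by (simp only: card_cartesian_product cardS)
  qed
  finally show ?thesis .
qed

theorem theorem1:
  fixes n k p r :: nat
  assumes "n + p \<ge> 1"
  shows "\<exists>\<Phi>. bij_betw \<Phi> (involutive_baxter_permutations n k p r) (walk_tuples n k p r)"
proof (rule finite_same_card_bij)
  obtain m where m: "n + p = Suc m"
    using assms by (cases "n + p") auto
  have "card (involutive_baxter_permutations n k p r) = (\<Sum>w | length w = m. if count_list w True = k
      then drops (False # w) 0 * ((p + r choose r) * gaps (False # w) r (p + r)) else 0)"
    \<comment> \<open>Words beginning with \<open>True\<close> contribute nothing, since
      \<open>drops (True # w) 0\<close> is an empty sum.\<close>
    unfolding card_involutive_baxter_permutations m sum_words_Suc by (simp cong: if_cong)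
  also have "\<dots> = (\<Sum>w | length w = m \<and> count_list w True = k.
      drops (False # w) 0 * ((p + r choose r) * gaps (False # w) r (p + r)))"
    using sum.inter_filter[OF finite_words, of "\<lambda>w. drops (False # w) 0 *
      ((p + r choose r) * gaps (False # w) r (p + r))" m "\<lambda>w. count_list w True = k"] by simp
  also have "\<dots> = card (walk_tuples n k p r)"
    unfolding card_walk_tuples[OF m] by (simp only: mult_ac)
  finally show "card (involutive_baxter_permutations n k p r) = card (walk_tuples n k p r)" .
  show "finite (involutive_baxter_permutations n k p r)"
    by (rule finite_subset[OF _ finite_permutations[of "{1..2 * n + p}"]])
      (auto simp: involutive_baxter_permutations_def baxter_def)
  show "finite (walk_tuples n k p r)" by (rule finite_walk_tuples)
qed

end
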